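(* Consider the two-queue exhaustive polling system without information. (i) If $c(1-\rho)>d$, there is a unique Nash equilibrium policy, $p=\tfrac12$, and this policy is socially optimal. (ii) If $c(1-\rho)=d$, every policy $p\in[0,1]$ is a Nash equilibrium policy, but only $p=\tfrac12$ is socially optimal. (iii) If $c(1-\rho)<d$, there are exactly three Nash equilibrium policies: $p=0$, $p=\tfrac12$ and $p=1$. Among these, only $p=\tfrac12$ is socially optimal if $c>d$; each of them is socially optimal if $c=d$; and $p=0$ and $p=1$ are the socially optimal ones if $c<d$.
   Context: Polling model: customers arrive according to a Poisson process with rate $\lambda>0$ at a system with two queues. Service times are independent and exponentially distributed with rate $\mu$ in each queue, and $\rho=\lambda/\mu<1$. A single server serves the two queues cyclically with exhaustive service: it serves a queue until that queue is empty and then moves to the other queue. Switch-over times are zero, so the server is never idle while customers are present. Within a queue, service is in order of arrival. The queue where the server is located is called the busy queue, the other one the idle queue. A customer pays cost at rate $c$ per unit time while she is in a queue that is being served (including her own service), and at rate $d$ per unit time while she is in a queue that is not being served; here $c>0$, $d\ge 0$. No information: arriving customers know neither the server position nor the queue lengths, so a policy is a number $p\in[0,1]$: each customer independently joins queue 1 with probability $p$ and queue 2 with probability $1-p$. For $i=1,2$, let $C_i(p)$ be the expected total cost of a customer who arrives at the system in steady state (under the policy $p$ followed by all other customers) and joins queue $i$. A policy $p\in[0,1]$ is socially optimal if it minimizes $C(p)=p\,C_1(p)+(1-p)\,C_2(p)$ over $[0,1]$. A policy $p\in[0,1]$ is a Nash equilibrium policy if, when all other customers use $p$, an individual customer cannot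 lower her own expected cost by deviating, i.e. $q=p$ minimizes $q\,C_1(p)+(1-q)\,C_2(p)$ over $q\in[0,1]$. *)

theory Defs
  imports "HOL-Probability.Probability"
begin

datatype queue = Q1 | Q2

instance queue :: finite
proof
  have "(UNIV :: queue set) = {Q1, Q2}"
    using queue.exhaust by auto
  then show "finite (UNIV :: queue set)"
    by (metis finite.emptyI finite.insertI)
qed

fun other :: "queue \<Rightarrow> queue" where
  "other Q1 = Q2"
| "other Q2 = Q1"

text \<open>A state consists of the queue at which the server is located and the numbers of customers
  in the two queues, including the customer in service.\<close>

type_synonym state = "queue \<times> (queue \<Rightarrow> nat)"

text \<open>Exhaustive service with zero switch-over times: as soon as the server's queue is empty and
  the other one is not, the server is at the other queue. If both queues are empty, the recorded
  position is immaterial, because \<open>settle\<close> is applied again at the next arrival.\<close>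

definition settle :: "state \<Rightarrow> state" where
  "settle x = (case x of (s, n) \<Rightarrow>
     if n s = 0 \<and> n (other s) > 0 then (other s, n) else (s, n))"

definition arrive :: "queue \<Rightarrow> state \<Rightarrow> state" where
  "arrive i x = (case x of (s, n) \<Rightarrow> settle (s, n(i := n i + 1)))"

definition serve :: "state \<Rightarrow> state" where
  "serve x = (case x of (s, n) \<Rightarrow> settle (s, n(s := n s - 1)))"

definition route :: "real \<Rightarrow> queue pmf" where
  "route p = map_pmf (\<lambda>b. if b then Q1 else Q2) (bernoulli_pmf p)"

text \<open>By the memoryless property the state is a continuous-time Markov chain with the following
  transition rates. States with the server at an empty queue while the other queue is nonempty
  are never entered, so they carry no stationary mass.\<close>

definition rate :: "real \<Rightarrow> real \<Rightarrow> real \<Rightarrow> state \<Rightarrow> state \<Rightarrow> real" where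
  "rate lam mu p x y =
     (\<Sum>i\<in>UNIV. if y = arrive i x then lam * pmf (route p) i else 0)
     + (if snd x (fst x) > 0 \<and> y = serve x then mu else 0)"

definition stationary :: "real \<Rightarrow> real \<Rightarrow> real \<Rightarrow> state pmf \<Rightarrow> bool" where
  "stationary lam mu p \<pi> \<longleftrightarrow>
     (\<forall>y. (\<Sum>\<^sub>\<infinity>x\<in>UNIV. pmf \<pi> x * rate lam mu p x y)
        = pmf \<pi> y * (\<Sum>\<^sub>\<infinity>z\<in>UNIV. rate lam mu p y z))"

definition steady_state :: "real \<Rightarrow> real \<Rightarrow> real \<Rightarrow> state pmf" where
  "steady_state lam mu p = (THE \<pi>. stationary lam mu p \<pi>)"

text \<open>The cost that a tagged customer in queue \<open>i\<close>, with \<open>k\<close> customers ahead of her in that queue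
  (including one in service), incurs during the next \<open>m\<close> events (arrivals and service completions).
  The heads of the two streams are the times until the next arrival (with the queue that this
  arrival joins) and until the next service completion; the tails are the subsequent interarrival
  and service times. The clock that does not ring keeps running with its residual time. The server
  is always working, since the tagged customer is present until her own service completion.\<close>

fun cost_upto :: "real \<Rightarrow> real \<Rightarrow> nat \<Rightarrow> state \<Rightarrow> queue \<Rightarrow> nat
    \<Rightarrow> (real \<times> queue) stream \<Rightarrow> real stream \<Rightarrow> ennreal" where
  "cost_upto c d 0 x i k as bs = 0"
| "cost_upto c d (Suc m) x i k as bs =
     (let (a, r) = shd as; b = shd bs in
        ennreal (if fst x = i then c else d) * ennreal (min a b) +
        (if a < b then cost_upto c d m (arrive r x) i k (stl as) ((b - a) ## stl bs)
         else if fst x \<noteq> i then cost_upto c d m (serve x) i k ((a - b, r) ## stl as) (stl bs)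
         else (case k of
             0 \<Rightarrow> 0
           | Suc k' \<Rightarrow> cost_upto c d m (serve x) i k' ((a - b, r) ## stl as) (stl bs))))"

text \<open>Total cost of a customer who finds state \<open>x\<close> on arrival and joins queue \<open>i\<close>.\<close>

definition total_cost :: "real \<Rightarrow> real \<Rightarrow> queue \<Rightarrow> state
    \<Rightarrow> (real \<times> queue) stream \<Rightarrow> real stream \<Rightarrow> ennreal" where
  "total_cost c d i x as bs = (SUP m. cost_upto c d m (arrive i x) i (snd x i) as bs)"

definition exponential :: "real \<Rightarrow> real measure" where
  "exponential l = density lborel (exponential_density l)"

definition arrivals :: "real \<Rightarrow> real \<Rightarrow> (real \<times> queue) stream measure" where
  "arrivals lam p = stream_space (exponential lam \<Otimes>\<^sub>M measure_pmf (route p))"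

definition services :: "real \<Rightarrow> real stream measure" where
  "services mu = stream_space (exponential mu)"

text \<open>Since arrivals are Poisson, an arriving customer finds the stationary distribution, and the
  future arrivals are independent of what she finds; the residual service time of the customer in
  service is again exponential. The expectation is taken in \<open>ennreal\<close>, so that it
  is meaningful without presupposing that it is finite.\<close>

definition expected_cost :: "real \<Rightarrow> real \<Rightarrow> real \<Rightarrow> real \<Rightarrow> queue \<Rightarrow> real \<Rightarrow> ennreal" where
  "expected_cost lam mu c d i p =
     (\<integral>\<^sup>+ (x, as, bs). total_cost c d i x as bs
        \<partial>(measure_pmf (steady_state lam mu p) \<Otimes>\<^sub>M (arrivals lam p \<Otimes>\<^sub>M services mu)))"

text \<open>Expected cost of a customer who joins queue 1 with probability \<open>q\<close> and queue 2 otherwise,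
  when all other customers use policy \<open>p\<close>.\<close>

definition policy_cost :: "real \<Rightarrow> real \<Rightarrow> real \<Rightarrow> real \<Rightarrow> real \<Rightarrow> real \<Rightarrow> ennreal" where
  "policy_cost lam mu c d q p =
     ennreal q * expected_cost lam mu c d Q1 p + ennreal (1 - q) * expected_cost lam mu c d Q2 p"

definition nash :: "real \<Rightarrow> real \<Rightarrow> real \<Rightarrow> real \<Rightarrow> real \<Rightarrow> bool" where
  "nash lam mu c d p \<longleftrightarrow> p \<in> {0..1} \<and>
     (\<forall>q\<in>{0..1}. policy_cost lam mu c d p p \<le> policy_cost lam mu c d q p)"

definition socially_optimal :: "real \<Rightarrow> real \<Rightarrow> real \<Rightarrow> real \<Rightarrow> real \<Rightarrow> bool" where
  "socially_optimal lam mu c d p \<longleftrightarrow> p \<in> {0..1} \<and>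
     (\<forall>q\<in>{0..1}. policy_cost lam mu c d p p \<le> policy_cost lam mu c d q q)"

end

theory Submission
  imports Defs
begin

text \<open>The stationary law is determined through busy periods: the total number of customers has negative
  geometric drift, so the expected number of visits to a state during a busy period is finite, and every
  stationary distribution is proportional to it on the states with customers present. This gives
  existence, uniqueness and geometric tails, hence all moments.

  The memoryless property turns the expected cost of a tagged customer into a recursion along the
  embedded jump chain. A customer who finds \<open>n\<close> customers in her queue \<open>i\<close> and the server
  at the other queue \<open>j\<close> with \<open>m > 0\<close> customers waits for a busy period of \<open>j\<close>, so she pays
  \<open>d m / (mu - lam\<^sub>j) + c (n + 1) / mu\<close> on average.

  The required means follow from stationarity applied to the functions \<open>n\<^sub>i\<close>, \<open>n\<^sub>i\<^sup>2\<close> and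
  \<open>n\<^sub>1 n\<^sub>2\<close> restricted to the server being at a given queue. They form a linear system, whose
  solution shows that \<open>C\<^sub>1 - C\<^sub>2\<close> is a positive multiple of \<open>(2p - 1) (c (1 - \<rho>) - d)\<close>, and that
  the mean cost is, up to a constant, \<open>d - c\<close> times an increasing function of \<open>p (1 - p)\<close>.\<close>

section \<open>Balance equations\<close>

text \<open>The number \<open>z\<close>, strictly between 1 and mu / lam, encodes stability. On
  average \<open>z ^ customers\<close> shrinks by a fixed factor per jump of the busy system; this
  yields finite busy periods, the tails of the stationary law and the decay of the cost still
  outstanding after m events. The range of \<open>z\<close> does not depend on p, so one
  \<open>z\<close> serves all policies, as the comparison in \<open>socially_optimal\<close>
  requires.

  Two features of the definitions shape the work. \<open>steady_state\<close> is a definite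
  description, and the recorded server position makes the empty system two states, so uniqueness
  must cover the split between \<open>vacant Q1\<close> and \<open>vacant Q2\<close>. The cost is
  given pathwise, with residual clocks put back on the streams, as a supremum over event counts: its
  mean is the limit of a recursion, and a closed form solving the recursion is this limit only once
  the remainder is shown to vanish. Sums and integrals live in \<open>ennreal\<close>, where they
  may be interchanged freely; finiteness has to be supplied wherever terms are cancelled.\<close>

lemma UNIV_queue: "(UNIV :: queue set) = {Q1, Q2}"
  using queue.exhaust by auto

lemma other_neq [simp]: "other i \<noteq> i" "i \<noteq> other i"
  by (cases i; simp)+

lemma other_other [simp]: "other (other i) = i"
  by (cases i; simp)

lemma queue_neq: "(i :: queue) \<noteq> j \<longleftrightarrow> i = other j"
  by (cases i; cases j; simp)

lemma nn_integral_count_space_single: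
  fixes f :: "'a \<Rightarrow> ennreal"
  assumes "\<And>y. y \<noteq> a \<Longrightarrow> f y = 0"
  shows "(\<integral>\<^sup>+y. f y \<partial>count_space UNIV) = f a"
  by (subst nn_integral_count_space'[of "{a}"]) (use assms in auto)

text \<open>A real \<open>infsum\<close> is 0 by convention on families that are not summable;
  finiteness of the integral rules this out. This links the sums in \<open>stationary\<close> to
  integrals.\<close>

lemma ennreal_infsum_eq_nn_integral:
  fixes f :: "'a \<Rightarrow> real"
  assumes "\<And>x. 0 \<le> f x" and fin: "(\<integral>\<^sup>+x. ennreal (f x) \<partial>count_space UNIV) < \<infinity>"
  shows "ennreal (infsum f UNIV) = (\<integral>\<^sup>+x. ennreal (f x) \<partial>count_space UNIV)"
proof -
  have int: "integrable (count_space UNIV) f"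
    by (rule integrableI_nonneg) (use assms in auto)
  then have "infsum f UNIV = (LINT x|count_space UNIV. f x)"
    by (subst infsetsum_infsum[symmetric]) (auto simp: abs_summable_on_def infsetsum_def)
  then show ?thesis
    using nn_integral_eq_integral[OF int] assms by simp
qed

section \<open>States with customers present and the two empty states\<close>

definition busy :: "state \<Rightarrow> bool" where
  "busy x \<longleftrightarrow> snd x (fst x) > 0"

definition single :: "queue \<Rightarrow> state" where
  "single i = (i, (\<lambda>_. 0)(i := 1))"

definition vacant :: "queue \<Rightarrow> state" where
  "vacant i = (i, \<lambda>_. 0)"

lemma busy_single [simp]: "busy (single i)"
  by (simp add: busy_def single_def)

lemma not_busy_vacant [simp]: "\<not> busy (vacant i)"
  by (simp add: busy_def vacant_def)

lemma busy_arrive: "busy (arrive i x)"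
  by (cases x; cases "fst x"; cases i) (auto simp: busy_def arrive_def settle_def)

lemma arrive_vacant [simp]: "arrive i (vacant j) = single i"
  by (cases i; cases j) (auto simp: vacant_def single_def arrive_def settle_def fun_eq_iff)

lemma serve_single [simp]: "serve (single i) = vacant i"
  by (cases i) (auto simp: vacant_def single_def serve_def settle_def fun_eq_iff)

lemma single_inj [simp]: "single i = single j \<longleftrightarrow> i = j"
  by (auto simp: single_def)

lemma fun_queue_eq_iff: "(f :: queue \<Rightarrow> 'a) = g \<longleftrightarrow> f Q1 = g Q1 \<and> f Q2 = g Q2"
  by (metis ext queue.exhaust)

text \<open>The system empties only by the service of its sole customer, and the recorded server
  position stays at her queue. This is what gives each of the two empty states its own balance
  equation.\<close>

lemma serve_eq_vacant: "busy x \<Longrightarrow> serve x = vacant i \<longleftrightarrow> x = single i"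
  by (cases x; cases "fst x"; cases i)
     (auto simp: vacant_def single_def serve_def settle_def busy_def fun_queue_eq_iff)

lemma busy_or_vacant_serve: "busy x \<Longrightarrow> busy (serve x) \<or> (\<exists>i. serve x = vacant i)"
  by (cases x; cases "fst x")
     (auto simp: vacant_def serve_def settle_def busy_def fun_queue_eq_iff)

lemma vacant_inj [simp]: "vacant i = vacant j \<longleftrightarrow> i = j"
  by (auto simp: vacant_def)

lemma sum_queue: "(\<Sum>i\<in>UNIV. f i) = f Q1 + f Q2"
  by (simp add: UNIV_queue)

lemma customers_arrive: "(\<Sum>j\<in>UNIV. snd (arrive i x) j) = Suc (\<Sum>j\<in>UNIV. snd x j)"
  by (cases x; cases i) (auto simp: sum_queue arrive_def settle_def)

lemma customers_serve: "busy x \<Longrightarrow> Suc (\<Sum>j\<in>UNIV. snd (serve x) j) = (\<Sum>j\<in>UNIV. snd x j)"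
  by (cases x; cases "fst x") (auto simp: sum_queue serve_def settle_def busy_def)

locale polling =
  fixes lam mu p z :: real
  assumes lam_pos: "lam > 0" and p01: "p \<in> {0..1}" and z1: "1 < z" and zmu: "lam * z < mu"
begin

lemma lam_mu: "lam < mu"
  using mult_strict_left_mono[OF z1 lam_pos] zmu by simp

lemma mu_pos: "mu > 0"
  using lam_pos lam_mu by simp

definition queue_rate :: "queue \<Rightarrow> real" where
  "queue_rate i = lam * pmf (route p) i"

lemma pmf_route: "pmf (route p) Q1 = p" "pmf (route p) Q2 = 1 - p"
proof -
  have *: "inj (\<lambda>b. if b then Q1 else Q2)"
    by (auto simp: inj_def)
  show "pmf (route p) Q1 = p" "pmf (route p) Q2 = 1 - p"
    unfolding route_def using pmf_map_inj'[OF *, of "bernoulli_pmf p" True]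
      pmf_map_inj'[OF *, of "bernoulli_pmf p" False] p01 by simp_all
qed

lemma queue_rate_nonneg [simp]: "0 \<le> queue_rate i"
  using lam_pos by (simp add: queue_rate_def)

lemma queue_rate_sum: "queue_rate Q1 + queue_rate Q2 = lam"
  by (simp add: queue_rate_def pmf_route algebra_simps)

lemma queue_rate_Q: "queue_rate Q1 = lam * p" "queue_rate Q2 = lam * (1 - p)"
  by (simp_all add: queue_rate_def pmf_route)

text \<open>The generator without its diagonal term. Organised by events instead of target states,
  it is a finite sum.\<close>

definition jumps :: "(state \<Rightarrow> ennreal) \<Rightarrow> state \<Rightarrow> ennreal" where
  "jumps f x = (\<Sum>i\<in>UNIV. ennreal (queue_rate i) * f (arrive i x)) + (if busy x then ennreal mu * f (serve x) else 0)"

definition exit_rate :: "state \<Rightarrow> ennreal" where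
  "exit_rate x = ennreal lam + (if busy x then ennreal mu else 0)"

lemma rate_nonneg: "0 \<le> rate lam mu p x y"
  unfolding rate_def using lam_pos mu_pos by (intro add_nonneg_nonneg sum_nonneg) auto

lemma nn_integral_rate:
  "(\<integral>\<^sup>+y. ennreal (rate lam mu p x y) * f y \<partial>count_space UNIV) = jumps f x"
proof -
  have *: "ennreal (rate lam mu p x y) * f y =
      (if y = arrive Q1 x then ennreal (queue_rate Q1) * f y else 0) +
      (if y = arrive Q2 x then ennreal (queue_rate Q2) * f y else 0) +
      (if y = serve x then (if busy x then ennreal mu * f y else 0) else 0)" for y
    using lam_pos mu_pos
    by (auto simp: rate_def sum_queue queue_rate_def[symmetric] busy_def ennreal_plus distrib_right)
  show ?thesis
    unfolding * jumps_def sum_queue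
    by (simp add: nn_integral_add nn_integral_count_space_single[where a="arrive Q1 x"]
        nn_integral_count_space_single[where a="arrive Q2 x"]
        nn_integral_count_space_single[where a="serve x"])
qed

lemma ennreal_queue_rate_sum: "ennreal (queue_rate Q1) + ennreal (queue_rate Q2) = ennreal lam"
  by (simp add: queue_rate_sum flip: ennreal_plus)

lemma jumps_1: "jumps (\<lambda>_. 1) x = exit_rate x"
  by (simp add: jumps_def exit_rate_def sum_queue ennreal_queue_rate_sum)

lemma jumps_eq_rate: "jumps (indicator {y}) x = ennreal (rate lam mu p x y)"
  unfolding nn_integral_rate[symmetric]
  by (subst nn_integral_count_space_single[where a=y]) auto

lemma exit_rate_finite: "exit_rate x < \<infinity>"
  by (simp add: exit_rate_def)

lemma exit_rate_le: "exit_rate x \<le> ennreal (lam + mu)"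
  using lam_pos mu_pos by (auto simp: exit_rate_def ennreal_plus)

lemma jumps_le_exit_rate: "(\<And>x. f x \<le> 1) \<Longrightarrow> jumps f x \<le> exit_rate x"
proof -
  assume "\<And>x. f x \<le> 1"
  then have "c * f y \<le> c * 1" for c y
    by (intro mult_left_mono) auto
  then have "jumps f x \<le> jumps (\<lambda>_. 1) x"
    unfolding jumps_def sum_queue by (intro add_mono) (auto simp del: mult_1_right split_paired_All)
  then show ?thesis
    by (simp only: jumps_1)
qed

lemma infsum_rate: "ennreal (\<Sum>\<^sub>\<infinity>z\<in>UNIV. rate lam mu p y z) = exit_rate y"
  using nn_integral_rate[of y "\<lambda>_. 1"]
  by (subst ennreal_infsum_eq_nn_integral) (auto simp: rate_nonneg jumps_1 exit_rate_finite[unfolded infinity_ennreal_def])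

lemma infsum_flow:
  "ennreal (\<Sum>\<^sub>\<infinity>x\<in>UNIV. pmf \<pi> x * rate lam mu p x y) = (\<integral>\<^sup>+x. jumps (indicator {y}) x \<partial>measure_pmf \<pi>)"
proof -
  have *: "(\<integral>\<^sup>+x. ennreal (pmf \<pi> x * rate lam mu p x y) \<partial>count_space UNIV) =
      (\<integral>\<^sup>+x. jumps (indicator {y}) x \<partial>measure_pmf \<pi>)"
    by (simp add: nn_integral_measure_pmf jumps_eq_rate ennreal_mult rate_nonneg)
  also have "\<dots> \<le> (\<integral>\<^sup>+x. ennreal (lam + mu) \<partial>measure_pmf \<pi>)"
    by (intro nn_integral_mono order.trans[OF jumps_le_exit_rate exit_rate_le]) (auto simp: indicator_def)
  also have "\<dots> < \<infinity>"
    by (simp add: measure_pmf.emeasure_space_1[simplified])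
  finally show ?thesis
    by (subst ennreal_infsum_eq_nn_integral) (auto simp: rate_nonneg *)
qed

text \<open>All rates out of a state add up to at most lam + mu, so the real sums in the balance
  equations converge and nothing is lost by passing to \<open>ennreal\<close>.\<close>

lemma stationary_point_iff:
  "stationary lam mu p \<pi> \<longleftrightarrow>
     (\<forall>y. (\<integral>\<^sup>+x. jumps (indicator {y}) x \<partial>measure_pmf \<pi>) = ennreal (pmf \<pi> y) * exit_rate y)"
proof -
  have "((\<Sum>\<^sub>\<infinity>x\<in>UNIV. pmf \<pi> x * rate lam mu p x y) = pmf \<pi> y * (\<Sum>\<^sub>\<infinity>z\<in>UNIV. rate lam mu p y z))
    \<longleftrightarrow> ((\<integral>\<^sup>+x. jumps (indicator {y}) x \<partial>measure_pmf \<pi>) = ennreal (pmf \<pi> y) * exit_rate y)" for y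
    unfolding infsum_flow[symmetric] infsum_rate[symmetric]
    by (subst ennreal_mult[symmetric]) (auto simp: rate_nonneg infsum_nonneg intro!: ennreal_inj[symmetric])
  then show ?thesis
    unfolding stationary_def by blast
qed

text \<open>A nonnegative \<open>f\<close> is a superposition of point indicators, and Tonelli
  permits summing the pointwise balance equations. Both sides may be infinite.\<close>

lemma stationary_integral:
  assumes "stationary lam mu p \<pi>"
  shows "(\<integral>\<^sup>+x. jumps f x \<partial>measure_pmf \<pi>) = (\<integral>\<^sup>+x. exit_rate x * f x \<partial>measure_pmf \<pi>)"
proof -
  have "(\<integral>\<^sup>+x. jumps f x \<partial>measure_pmf \<pi>) =
    (\<integral>\<^sup>+x. (\<integral>\<^sup>+y. ennreal (pmf \<pi> x) * (ennreal (rate lam mu p x y) * f y) \<partial>count_space UNIV) \<partial>count_space UNIV)"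
    by (simp add: nn_integral_measure_pmf nn_integral_rate[symmetric] nn_integral_cmult)
  also have "\<dots> = (\<integral>\<^sup>+y. (\<integral>\<^sup>+x. ennreal (pmf \<pi> x) * (ennreal (rate lam mu p x y) * f y) \<partial>count_space UNIV) \<partial>count_space UNIV)"
    by (rule nn_integral_count_space_nn_integral) auto
  also have "\<dots> = (\<integral>\<^sup>+y. (\<integral>\<^sup>+x. jumps (indicator {y}) x \<partial>measure_pmf \<pi>) * f y \<partial>count_space UNIV)"
    by (simp add: nn_integral_measure_pmf jumps_eq_rate nn_integral_multc mult.assoc[symmetric])
  also have "\<dots> = (\<integral>\<^sup>+y. ennreal (pmf \<pi> y) * (exit_rate y * f y) \<partial>count_space UNIV)"
    by (simp only: assms[unfolded stationary_point_iff, rule_format] mult.assoc)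
  finally show ?thesis
    by (simp add: nn_integral_measure_pmf)
qed

end

section \<open>Stationary distribution\<close>

context polling
begin

text \<open>Transition operator of the jump chain, killed when the system becomes empty.\<close>

definition busy_step :: "(state \<Rightarrow> ennreal) \<Rightarrow> state \<Rightarrow> ennreal" where
  "busy_step f x = (if busy x then ennreal (1 / (lam + mu)) * jumps f x else 0)"

definition entry :: "(state \<Rightarrow> ennreal) \<Rightarrow> ennreal" where
  "entry f = (\<Sum>i\<in>UNIV. ennreal (pmf (route p) i) * f (single i))"

text \<open>Expected sum of \<open>f\<close> over the jump chain during a busy period.\<close>

definition excursion :: "(state \<Rightarrow> ennreal) \<Rightarrow> ennreal" where
  "excursion f = (\<Sum>n. entry ((busy_step ^^ n) f))"

section \<open>Monotonicity and linearity of the killed jump chain\<close>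

lemma jumps_mono:
  assumes "\<And>x. f x \<le> g x"
  shows "jumps f x \<le> jumps g x"
  unfolding jumps_def sum_queue by (simp add: add_mono mult_left_mono assms)

lemma busy_step_mono: "(\<And>x. f x \<le> g x) \<Longrightarrow> busy_step f x \<le> busy_step g x"
  by (auto simp: busy_step_def simp del: split_paired_All intro!: mult_left_mono jumps_mono)

lemma busy_step_pow_mono: "(\<And>x. f x \<le> g x) \<Longrightarrow> (busy_step ^^ n) f x \<le> (busy_step ^^ n) g x"
  by (induction n arbitrary: x) (auto simp del: split_paired_All intro: busy_step_mono)

lemma entry_mono:
  assumes "\<And>x. f x \<le> g x"
  shows "entry f \<le> entry g"
  unfolding entry_def sum_queue by (simp add: add_mono mult_left_mono assms)

lemma excursion_mono: "(\<And>x. f x \<le> g x) \<Longrightarrow> excursion f \<le> excursion g"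
  unfolding excursion_def by (intro suminf_le entry_mono busy_step_pow_mono) auto

lemma jumps_cmult: "jumps (\<lambda>x. c * f x) x = c * jumps f x"
  by (simp add: jumps_def sum_queue distrib_left mult_ac)

lemma busy_step_cmult: "busy_step (\<lambda>x. c * f x) x = c * busy_step f x"
  by (simp add: busy_step_def jumps_cmult mult_ac)

lemma entry_cmult: "entry (\<lambda>x. c * f x) = c * entry f"
  by (simp add: entry_def sum_queue distrib_left mult_ac)

lemma busy_step_add: "busy_step (\<lambda>x. f x + g x) x = busy_step f x + busy_step g x"
  by (simp add: busy_step_def jumps_def sum_queue distrib_left add_ac)

lemma busy_step_pow_add: "(busy_step ^^ n) (\<lambda>x. f x + g x) x = (busy_step ^^ n) f x + (busy_step ^^ n) g x"
proof (induction n arbitrary: x)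
  case (Suc n)
  then have "(busy_step ^^ n) (\<lambda>x. f x + g x) = (\<lambda>x. (busy_step ^^ n) f x + (busy_step ^^ n) g x)"
    by blast
  then show ?case
    by (simp add: busy_step_add)
qed simp

lemma busy_step_pow_cmult: "(busy_step ^^ n) (\<lambda>x. c * f x) x = c * (busy_step ^^ n) f x"
proof (induction n arbitrary: x)
  case (Suc n)
  then have "(busy_step ^^ n) (\<lambda>x. c * f x) = (\<lambda>x. c * (busy_step ^^ n) f x)"
    by blast
  then show ?case
    by (simp add: busy_step_cmult)
qed simp

lemma excursion_add: "excursion (\<lambda>x. f x + g x) = excursion f + excursion g"
  unfolding excursion_def by (subst suminf_add) (auto simp: busy_step_pow_add entry_def sum_queue distrib_left add_ac)

lemma excursion_cmult: "excursion (\<lambda>x. c * f x) = c * excursion f"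
  unfolding excursion_def by (subst ennreal_suminf_cmult[symmetric]) (auto simp: busy_step_pow_cmult entry_def sum_queue distrib_left mult_ac)

lemma busy_step_nn_integral:
  "busy_step (\<lambda>x. \<integral>\<^sup>+y. H y x \<partial>count_space UNIV) x = (\<integral>\<^sup>+y. busy_step (H y) x \<partial>count_space UNIV)"
  by (simp add: busy_step_def jumps_def sum_queue nn_integral_add nn_integral_cmult)

lemma busy_step_pow_point: "(busy_step ^^ n) f x = (\<integral>\<^sup>+y. f y * (busy_step ^^ n) (indicator {y}) x \<partial>count_space UNIV)"
proof (induction n arbitrary: x)
  case 0
  show ?case
    by (subst nn_integral_count_space_single[where a=x]) auto
next
  case (Suc n)
  then have "(busy_step ^^ n) f = (\<lambda>x. \<integral>\<^sup>+y. f y * (busy_step ^^ n) (indicator {y}) x \<partial>count_space UNIV)"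
    by blast
  then show ?case
    by (simp add: busy_step_nn_integral busy_step_cmult)
qed

text \<open>By linearity, the values \<open>excursion (indicator {y})\<close> form the occupation
  measure (Green kernel) of one busy period.\<close>

lemma excursion_point: "excursion f = (\<integral>\<^sup>+y. f y * excursion (indicator {y}) \<partial>count_space UNIV)"
proof -
  have "entry ((busy_step ^^ n) f) = (\<integral>\<^sup>+y. f y * entry ((busy_step ^^ n) (indicator {y})) \<partial>count_space UNIV)" for n
    unfolding entry_def sum_queue
    by (simp add: busy_step_pow_point[of n f] nn_integral_add[symmetric] nn_integral_cmult[symmetric] distrib_left mult_ac)
  then show ?thesis
    unfolding excursion_def by (simp add: nn_integral_suminf[symmetric])
qed

text \<open>The term n = 0 is the state that opens the busy period; the shifted remainder is the
  same series for \<open>busy_step f\<close>.\<close>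

lemma excursion_unfold: "excursion f = entry f + excursion (busy_step f)"
proof -
  have "excursion f = (\<Sum>n. entry ((busy_step ^^ Suc n) f)) + entry ((busy_step ^^ 0) f)"
    unfolding excursion_def by (subst suminf_offset[of _ 1]) auto
  then show ?thesis
    by (simp add: excursion_def funpow_Suc_right add.commute del: funpow.simps(2))
qed

lemma jumps_vacant: "jumps f (vacant s) = ennreal lam * entry f"
  using lam_pos by (simp add: jumps_def entry_def sum_queue queue_rate_def ennreal_mult distrib_left mult_ac)

section \<open>Geometric drift of the total number of customers\<close>

definition contraction :: real where
  "contraction = (lam * z + mu / z) / (lam + mu)"

lemma contraction_pos: "contraction > 0"
  using lam_pos mu_pos z1 by (auto simp: contraction_def intro!: divide_pos_pos add_pos_pos)

text \<open>After multiplication by z the difference of the two sides is (z - 1) * (mu - lam * z),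
  which is positive by the choice of \<open>z\<close>. Division by lam + mu turns the left side into
  \<open>contraction\<close>, the mean factor of z ^ customers per jump.\<close>

lemma drift: "lam * z + mu / z < lam + mu"
proof -
  have "(z - 1) * (lam * z) < (z - 1) * mu"
    using z1 zmu by simp
  moreover have "(lam * z + mu / z) * z = lam * z * z + mu"
    using z1 by (simp add: distrib_right)
  ultimately have "(lam * z + mu / z) * z < (lam + mu) * z"
    by (simp add: algebra_simps)
  then show ?thesis
    using z1 by simp
qed

lemma contraction_less_1: "contraction < 1"
  using drift lam_pos mu_pos by (simp add: contraction_def)

abbreviation customers :: "state \<Rightarrow> nat" where
  "customers x \<equiv> (\<Sum>i\<in>UNIV. snd x i)"

definition weight :: "state \<Rightarrow> ennreal" where
  "weight x = (if busy x then ennreal (z ^ customers x) else 0)"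

text \<open>A Foster-Lyapunov inequality: arrivals multiply the weight by z and services divide it
  by z. It is not an equality because the service that empties the system lands on weight 0 instead
  of z ^ 0 = 1.\<close>

lemma busy_step_weight: "busy_step weight x \<le> ennreal contraction * weight x"
proof (cases "busy x")
  case True
  then obtain m where m: "customers x = Suc m" "customers (serve x) = m"
    using customers_serve by metis
  have "jumps weight x \<le> ennreal (queue_rate Q1) * ennreal (z ^ customers (arrive Q1 x)) +
      ennreal (queue_rate Q2) * ennreal (z ^ customers (arrive Q2 x)) + ennreal mu * ennreal (z ^ customers (serve x))"
    using True by (auto simp: jumps_def sum_queue weight_def intro!: add_mono mult_left_mono)
  also have "\<dots> = (ennreal (queue_rate Q1) + ennreal (queue_rate Q2)) * ennreal (z * z ^ customers x) + ennreal mu * ennreal (z ^ m)"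
    by (simp only: customers_arrive m power_Suc distrib_right)
  also have "\<dots> = ennreal (lam * (z * z ^ customers x) + mu * z ^ m)"
    using lam_pos mu_pos z1 by (simp add: ennreal_queue_rate_sum ennreal_plus ennreal_mult)
  also have "lam * (z * z ^ customers x) + mu * z ^ m = (lam * z + mu / z) * z ^ customers x"
    using z1 m by (simp add: field_simps)
  finally have "busy_step weight x \<le> ennreal (1 / (lam + mu)) * ennreal ((lam * z + mu / z) * z ^ customers x)"
    using True by (auto simp: busy_step_def intro!: mult_left_mono)
  also have "\<dots> = ennreal contraction * weight x"
    using True lam_pos mu_pos z1 by (simp add: weight_def contraction_def ennreal_mult[symmetric])
  finally show ?thesis .
qed (simp add: busy_step_def)

lemma busy_step_pow_weight: "(busy_step ^^ n) weight x \<le> ennreal (contraction ^ n) * weight x"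
proof (induction n arbitrary: x)
  case (Suc n)
  have "(busy_step ^^ Suc n) weight x \<le> busy_step (\<lambda>x. ennreal (contraction ^ n) * weight x) x"
    by (auto simp del: split_paired_All intro!: busy_step_mono Suc)
  also have "\<dots> \<le> ennreal (contraction ^ n) * (ennreal contraction * weight x)"
    unfolding busy_step_cmult by (intro mult_left_mono busy_step_weight) auto
  also have "\<dots> = ennreal (contraction ^ Suc n) * weight x"
    using contraction_pos by (simp add: ennreal_mult mult_ac)
  finally show ?case .
qed simp

lemma entry_weight_finite: "entry weight < \<infinity>"
  by (simp add: entry_def sum_queue weight_def ennreal_mult_less_top)

lemma excursion_weight_finite: "excursion weight < \<infinity>"
proof -
  have "excursion weight \<le> (\<Sum>n. ennreal (contraction ^ n) * entry weight)"
    unfolding excursion_def entry_cmult[symmetric] by (intro suminf_le entry_mono busy_step_pow_weight) auto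
  also have "\<dots> = ennreal (1 / (1 - contraction)) * entry weight"
    using contraction_pos contraction_less_1
    by (subst ennreal_suminf_multc, subst suminf_ennreal2) (auto simp: suminf_geometric)
  also have "\<dots> < \<infinity>"
    using entry_weight_finite by (simp add: ennreal_mult_less_top)
  finally show ?thesis .
qed

section \<open>Mean visit counts of a busy period\<close>

definition busy_ind :: "state \<Rightarrow> ennreal" where
  "busy_ind x = (if busy x then 1 else 0)"

lemma busy_ind_le_weight: "busy_ind x \<le> weight x"
  using z1 by (auto simp: busy_ind_def weight_def)

lemma excursion_busy_ind_finite: "excursion busy_ind < \<infinity>"
  using excursion_mono[of busy_ind weight, OF busy_ind_le_weight] excursion_weight_finite by (rule le_less_trans)

lemma entry_busy_ind: "entry busy_ind = 1"
  using ennreal_plus[of p "1 - p"] p01 by (simp add: entry_def sum_queue busy_ind_def pmf_route)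

text \<open>A busy period ends exactly once, by a service in some \<open>single i\<close>, which is
  the next event there with probability mu / (lam + mu). So the mean number of visits to these two
  states times this probability is 1.\<close>

lemma excursion_single: "ennreal mu * (excursion (indicator {single Q1}) + excursion (indicator {single Q2})) = ennreal (lam + mu)"
proof -
  \<comment> \<open>Probability balance of one jump: a busy state leads to a busy state unless its
    only customer is served.\<close>
  have "busy_ind x = busy_step busy_ind x + ennreal (mu / (lam + mu)) * (indicator {single Q1} x + indicator {single Q2} x)" for x
  proof (cases "busy x")
    case True
    have jumps: "jumps busy_ind x = ennreal (lam + (if busy (serve x) then mu else 0))"
      using True lam_pos mu_pos by (simp add: jumps_def busy_ind_def sum_queue busy_arrive ennreal_queue_rate_sum ennreal_plus)
    show ?thesis
    proof (cases "busy (serve x)")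
      case busy': True
      then have "x \<noteq> single i" for i
        by auto
      then show ?thesis
        using True busy' jumps lam_pos mu_pos by (simp add: busy_ind_def busy_step_def ennreal_mult[symmetric] del: ennreal_plus)
    next
      case False
      then obtain i where i: "x = single i"
        using True busy_or_vacant_serve serve_eq_vacant by blast
      have "ennreal (1 / (lam + mu)) * ennreal lam = ennreal (lam / (lam + mu))"
        using lam_pos mu_pos by (simp add: ennreal_mult[symmetric])
      moreover have "ennreal (lam / (lam + mu)) + ennreal (mu / (lam + mu)) = 1"
        using lam_pos mu_pos by (simp add: ennreal_plus[symmetric] add_divide_distrib[symmetric] del: ennreal_plus)
      ultimately show ?thesis
        using i jumps False by (cases i) (auto simp: busy_ind_def busy_step_def indicator_def)
    qed
  qed (auto simp: busy_ind_def busy_step_def indicator_def)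
  then have "excursion busy_ind = excursion (\<lambda>x. busy_step busy_ind x + ennreal (mu / (lam + mu)) * (indicator {single Q1} x + indicator {single Q2} x))"
    by (intro arg_cong[where f=excursion] ext)
  then have "excursion busy_ind = excursion (busy_step busy_ind) + ennreal (mu / (lam + mu)) * (excursion (indicator {single Q1}) + excursion (indicator {single Q2}))"
    by (simp only: excursion_add excursion_cmult)
  moreover have busy_ind: "excursion busy_ind = excursion (busy_step busy_ind) + 1"
    using excursion_unfold[of busy_ind] by (simp add: entry_busy_ind add.commute)
  ultimately have "excursion (busy_step busy_ind) + ennreal (mu / (lam + mu)) * (excursion (indicator {single Q1}) + excursion (indicator {single Q2})) = excursion (busy_step busy_ind) + 1"
    by simp
  \<comment> \<open>Finiteness of the mean number of jumps permits cancelling the common summand in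
    \<open>ennreal\<close>.\<close>
  moreover have "excursion (busy_step busy_ind) \<noteq> \<top>"
    using busy_ind excursion_busy_ind_finite by auto
  ultimately have "ennreal (mu / (lam + mu)) * (excursion (indicator {single Q1}) + excursion (indicator {single Q2})) = 1"
    by (simp only: ennreal_add_left_cancel infinity_ennreal_def) blast
  then have "ennreal (lam + mu) * (ennreal (mu / (lam + mu)) * (excursion (indicator {single Q1}) + excursion (indicator {single Q2}))) = ennreal (lam + mu)"
    by simp
  then show ?thesis
    using lam_pos mu_pos by (simp add: mult.assoc[symmetric] ennreal_mult[symmetric] del: ennreal_plus)
qed

text \<open>Up to the factor lam + mu, the mean time spent in each state during one busy period and
  the empty period after it. A visit lasts 1 / (lam + mu) in a busy state and 1 / lam in an empty
  one; with the probability mu / (lam + mu) of leaving \<open>single i\<close> by a service this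
  gives mu / lam.\<close>

definition cycle_weight :: "state \<Rightarrow> ennreal" where
  "cycle_weight y = (if busy y then excursion (indicator {y})
     else if y \<in> range vacant then ennreal (mu / lam) * excursion (indicator {single (fst y)}) else 0)"

lemma fst_vacant [simp]: "fst (vacant i) = i"
  by (simp add: vacant_def)

lemma nn_integral_cycle_weight:
  "(\<integral>\<^sup>+y. cycle_weight y * f y \<partial>count_space UNIV) = excursion (\<lambda>x. if busy x then f x else 0) +
     ennreal (mu / lam) * (excursion (indicator {single Q1}) * f (vacant Q1) + excursion (indicator {single Q2}) * f (vacant Q2))"
proof -
  have "cycle_weight y * f y = (if busy y then f y else 0) * excursion (indicator {y}) +
      (if y = vacant Q1 then ennreal (mu / lam) * (excursion (indicator {single Q1}) * f y) else 0) +
      (if y = vacant Q2 then ennreal (mu / lam) * (excursion (indicator {single Q2}) * f y) else 0)" for y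
    by (auto simp: cycle_weight_def UNIV_queue mult_ac)
  then show ?thesis
    by (simp add: nn_integral_add excursion_point[symmetric] nn_integral_count_space_single[where a="vacant Q1"]
        nn_integral_count_space_single[where a="vacant Q2"] distrib_left add_ac)
qed

lemma excursion_single_finite: "excursion (indicator {single i}) < \<infinity>"
  by (rule le_less_trans[OF excursion_mono excursion_busy_ind_finite]) (auto simp: busy_ind_def indicator_def)

lemma cycle_weight_finite: "(\<integral>\<^sup>+y. cycle_weight y * ennreal (z ^ customers y) \<partial>count_space UNIV) < \<infinity>"
  unfolding nn_integral_cycle_weight using excursion_weight_finite excursion_single_finite
  by (simp add: weight_def[abs_def, symmetric] ennreal_mult_less_top)

lemma cycle_weight_total_finite: "(\<integral>\<^sup>+y. cycle_weight y \<partial>count_space UNIV) < \<infinity>"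
  using nn_integral_cycle_weight[of "\<lambda>_. 1"] excursion_busy_ind_finite excursion_single_finite
  by (simp add: busy_ind_def[abs_def, symmetric] ennreal_mult_less_top)

lemma cycle_weight_total_pos: "0 < (\<integral>\<^sup>+y. cycle_weight y \<partial>count_space UNIV)"
proof -
  have "1 \<le> excursion busy_ind"
    using excursion_unfold[of busy_ind] by (simp add: entry_busy_ind)
  then have "0 < excursion busy_ind"
    by (rule less_le_trans[rotated]) simp
  then show ?thesis
    using nn_integral_cycle_weight[of "\<lambda>_. 1"] by (simp add: busy_ind_def[abs_def, symmetric] add_pos_nonneg)
qed

lemma jumps_indicator_unsettled:
  assumes "\<not> busy y" "y \<notin> range vacant"
  shows "jumps (indicator {y}) x = 0"
proof -
  have "arrive i x \<noteq> y" "busy x \<Longrightarrow> serve x \<noteq> y" for i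
    using assms busy_arrive[of i x] busy_or_vacant_serve[of x] by auto
  then show ?thesis
    by (auto simp: jumps_def)
qed

lemma jumps_indicator_vacant: "jumps (indicator {vacant s}) x = ennreal mu * indicator {single s} x"
proof -
  have "arrive i x \<noteq> vacant s" for i
    using busy_arrive[of i x] by auto
  then show ?thesis
    using serve_eq_vacant[of x s] by (auto simp: jumps_def indicator_def)
qed

lemma jumps_busy_eq_busy_step: "(if busy x then jumps f x else 0) = ennreal (lam + mu) * busy_step f x"
  using lam_pos mu_pos by (simp add: busy_step_def mult.assoc[symmetric] ennreal_mult[symmetric] del: ennreal_plus)

text \<open>A busy \<open>y\<close> is entered from busy states or from the empty system. The rate
  of the latter flow becomes (lam + mu) times \<open>entry\<close> by
  \<open>excursion_single\<close>, and \<open>excursion_unfold\<close> adds the two. An empty state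
  is entered from \<open>single s\<close> alone, and the remaining states are never entered and have
  weight 0.\<close>

lemma cycle_weight_balance: "(\<integral>\<^sup>+x. cycle_weight x * jumps (indicator {y}) x \<partial>count_space UNIV) = cycle_weight y * exit_rate y"
proof (cases "busy y")
  case True
  have "(\<integral>\<^sup>+x. cycle_weight x * jumps (indicator {y}) x \<partial>count_space UNIV) =
      ennreal (lam + mu) * excursion (busy_step (indicator {y})) + ennreal (mu / lam) * (ennreal lam *
        (excursion (indicator {single Q1}) + excursion (indicator {single Q2})) * entry (indicator {y}))"
    unfolding nn_integral_cycle_weight jumps_busy_eq_busy_step jumps_vacant excursion_cmult by (simp add: algebra_simps)
  also have "ennreal (mu / lam) * (ennreal lam *
        (excursion (indicator {single Q1}) + excursion (indicator {single Q2})) * entry (indicator {y})) =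
      ennreal (mu / lam * lam) * (excursion (indicator {single Q1}) + excursion (indicator {single Q2})) * entry (indicator {y})"
    using lam_pos mu_pos by (subst ennreal_mult) (auto simp: mult_ac)
  also have "\<dots> = ennreal (lam + mu) * entry (indicator {y})"
    using lam_pos by (simp add: excursion_single[symmetric])
  also have "ennreal (lam + mu) * excursion (busy_step (indicator {y})) + \<dots> = ennreal (lam + mu) * excursion (indicator {y})"
    by (subst (2) excursion_unfold) (simp only: distrib_left add.commute)
  finally show ?thesis
    using True lam_pos mu_pos by (simp add: cycle_weight_def exit_rate_def ennreal_plus mult.commute)
next
  case False
  show ?thesis
  proof (cases "y \<in> range vacant")
    case True
    then obtain s where s: "y = vacant s"
      by auto
    have "(\<integral>\<^sup>+x. cycle_weight x * jumps (indicator {y}) x \<partial>count_space UNIV) = cycle_weight (single s) * ennreal mu"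
      unfolding s jumps_indicator_vacant by (subst nn_integral_count_space_single[where a="single s"]) auto
    also have "\<dots> = cycle_weight y * exit_rate y"
    proof -
      have "mu = mu / lam * lam"
        using lam_pos by simp
      then have "ennreal mu = ennreal (mu / lam) * ennreal lam"
        using lam_pos mu_pos by (metis divide_nonneg_nonneg ennreal_mult less_imp_le)
      then show ?thesis
        by (simp add: s cycle_weight_def exit_rate_def mult_ac)
    qed
    finally show ?thesis .
  next
    case unsettled: False
    then show ?thesis
      using False by (simp add: jumps_indicator_unsettled cycle_weight_def)
  qed
qed

lemma stationary_exists:
  obtains \<pi> where "stationary lam mu p \<pi>" "(\<integral>\<^sup>+x. ennreal (z ^ customers x) \<partial>measure_pmf \<pi>) < \<infinity>"
proof -
  define T where "T = (\<integral>\<^sup>+y. cycle_weight y \<partial>count_space UNIV)"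
  have T: "0 < T" "T < \<infinity>"
    using cycle_weight_total_pos cycle_weight_total_finite by (auto simp: T_def)
  define T' where "T' = inverse T"
  have T': "T' * T = 1" "T' < \<infinity>"
    using T ennreal_divide_self[of T, unfolded divide_ennreal_def]
    by (auto simp: T'_def mult.commute ennreal_inverse_eq_top_iff less_top[symmetric])
  have cycle_weight_fin: "cycle_weight y < \<infinity>" for y
    using nn_integral_ge_point[of y UNIV cycle_weight] T(2) unfolding T_def by (auto intro: le_less_trans)
  have [simp]: "ennreal (enn2real (T' * cycle_weight y)) = T' * cycle_weight y" for y
    using cycle_weight_fin[of y] T' by (simp add: ennreal_mult_less_top)
  define \<pi> where "\<pi> = embed_pmf (\<lambda>y. enn2real (T' * cycle_weight y))"
  have pmf: "ennreal (pmf \<pi> y) = T' * cycle_weight y" for y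
    unfolding \<pi>_def by (subst pmf_embed_pmf) (auto simp: nn_integral_cmult T_def[symmetric] T')
  have int: "(\<integral>\<^sup>+x. f x \<partial>measure_pmf \<pi>) = T' * (\<integral>\<^sup>+x. cycle_weight x * f x \<partial>count_space UNIV)" for f
    by (simp add: nn_integral_measure_pmf pmf nn_integral_cmult mult.assoc)
  show ?thesis
  proof
    show "stationary lam mu p \<pi>"
      unfolding stationary_point_iff int cycle_weight_balance pmf by (simp add: mult.assoc)
    show "(\<integral>\<^sup>+x. ennreal (z ^ customers x) \<partial>measure_pmf \<pi>) < \<infinity>"
      unfolding int using T' cycle_weight_finite by (simp add: ennreal_mult_less_top)
  qed
qed

section \<open>Uniqueness by unrolling the balance equations\<close>

definition legit :: "state \<Rightarrow> bool" where
  "legit x \<longleftrightarrow> busy x \<or> x \<in> range vacant"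

lemma stationary_legit:
  assumes st: "stationary lam mu p \<pi>"
  shows "AE x in measure_pmf \<pi>. legit x"
proof -
  have *: "pmf \<pi> y = 0" if "\<not> legit y" for y
  proof -
    have "jumps (indicator {y}) = (\<lambda>_. 0)"
      using that jumps_indicator_unsettled[of y] by (auto simp: legit_def)
    then have "ennreal (pmf \<pi> y) * exit_rate y = 0"
      using st[unfolded stationary_point_iff, rule_format, of y] by simp
    then show ?thesis
      using lam_pos by (auto simp: exit_rate_def)
  qed
  show ?thesis
    unfolding AE_measure_pmf_iff
  proof
    fix x assume "x \<in> set_pmf \<pi>"
    then show "legit x"
      using *[of x] unfolding set_pmf_iff by metis
  qed
qed

text \<open>Busy states have exit rate lam + mu. Dividing the balance equation by it splits their
  mass into what one jump brings from busy states and what opens a busy period.\<close>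

lemma stationary_step:
  assumes st: "stationary lam mu p \<pi>" and f: "\<And>x. \<not> busy x \<Longrightarrow> f x = 0"
  shows "(\<integral>\<^sup>+x. f x \<partial>measure_pmf \<pi>) = (\<integral>\<^sup>+x. busy_step f x \<partial>measure_pmf \<pi>) +
    ennreal (lam / (lam + mu)) * emeasure (measure_pmf \<pi>) {x. \<not> busy x} * entry f"
proof -
  have eq: "ennreal (1 / (lam + mu)) * jumps f x = busy_step f x + ennreal (lam / (lam + mu)) * entry f * indicator {x. \<not> busy x} x"
    if "legit x" for x
  proof (cases "busy x")
    case False
    then obtain s where "x = vacant s"
      using \<open>legit x\<close> by (auto simp: legit_def)
    moreover have "ennreal (lam / (lam + mu)) = ennreal (1 / (lam + mu)) * ennreal lam"
      using lam_pos mu_pos by (simp add: ennreal_mult[symmetric])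
    ultimately show ?thesis
      by (simp add: busy_step_def jumps_vacant mult_ac)
  qed (simp add: busy_step_def)
  have "ennreal (1 / (lam + mu)) * (exit_rate x * f x) = f x" for x
    using f[of x] lam_pos mu_pos
    by (cases "busy x") (auto simp: exit_rate_def mult.assoc[symmetric] ennreal_mult[symmetric] ennreal_plus[symmetric] simp del: ennreal_plus)
  then have "(\<integral>\<^sup>+x. f x \<partial>measure_pmf \<pi>) = (\<integral>\<^sup>+x. ennreal (1 / (lam + mu)) * (exit_rate x * f x) \<partial>measure_pmf \<pi>)"
    by simp
  also have "\<dots> = (\<integral>\<^sup>+x. ennreal (1 / (lam + mu)) * jumps f x \<partial>measure_pmf \<pi>)"
    by (simp add: nn_integral_cmult stationary_integral[OF st])
  also have "\<dots> = (\<integral>\<^sup>+x. busy_step f x + ennreal (lam / (lam + mu)) * entry f * indicator {x. \<not> busy x} x \<partial>measure_pmf \<pi>)"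
    using stationary_legit[OF st] by (intro nn_integral_cong_AE) (auto simp: eq elim: eventually_mono)
  finally show ?thesis
    by (simp add: nn_integral_add nn_integral_cmult mult_ac)
qed

lemma busy_step_pow_idle: "(\<And>x. \<not> busy x \<Longrightarrow> f x = 0) \<Longrightarrow> \<not> busy x \<Longrightarrow> (busy_step ^^ n) f x = 0"
  by (cases n) (auto simp: busy_step_def)

text \<open>Iterating \<open>stationary_step\<close> builds up the series
  \<open>excursion f\<close>, and the remainder, the contribution of paths that stay busy for n
  jumps, tends to 0. So on busy states a stationary law is a multiple of the occupation measure,
  governed by its own probability of an empty system.\<close>

lemma stationary_eq_excursion:
  assumes st: "stationary lam mu p \<pi>" and f: "\<And>x. f x \<le> busy_ind x"
  shows "(\<integral>\<^sup>+x. f x \<partial>measure_pmf \<pi>) =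
    ennreal (lam / (lam + mu)) * emeasure (measure_pmf \<pi>) {x. \<not> busy x} * excursion f"
proof -
  let ?k = "ennreal (lam / (lam + mu)) * emeasure (measure_pmf \<pi>) {x. \<not> busy x}"
  have f0: "f x = 0" if "\<not> busy x" for x
    using f[of x] that by (simp add: busy_ind_def)
  have it: "(\<integral>\<^sup>+x. f x \<partial>measure_pmf \<pi>) = (\<integral>\<^sup>+x. (busy_step ^^ n) f x \<partial>measure_pmf \<pi>) + ?k * (\<Sum>k<n. entry ((busy_step ^^ k) f))" for n
  proof (induction n)
    case (Suc n)
    then show ?case
      using stationary_step[OF st, of "(busy_step ^^ n) f", OF busy_step_pow_idle[OF f0]]
      by (simp add: distrib_left add_ac)
  qed simp
  \<comment> \<open>The killed chain does not increase the supremum, so the constant 1 dominates all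
    iterates.\<close>
  have bound: "(busy_step ^^ n) f x \<le> 1" for n x
  proof (induction n arbitrary: x)
    case 0
    then show ?case
      using order.trans[OF f, of x 1] by (simp add: busy_ind_def)
  next
    case (Suc n)
    have "busy_step ((busy_step ^^ n) f) x \<le> ennreal (1 / (lam + mu)) * jumps ((busy_step ^^ n) f) x"
      by (simp add: busy_step_def[of "(busy_step ^^ n) f" x])
    also have "\<dots> \<le> ennreal (1 / (lam + mu)) * ennreal (lam + mu)"
      using jumps_le_exit_rate[of "(busy_step ^^ n) f" x, OF Suc] exit_rate_le[of x] by (intro mult_left_mono) auto
    also have "\<dots> = 1"
      using lam_pos mu_pos by (simp add: ennreal_mult[symmetric] del: ennreal_plus)
    finally show ?case
      by simp
  qed
  \<comment> \<open>Decay holds for each \<open>x\<close> but not uniformly, as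
    \<open>weight\<close> is unbounded; this is why dominated convergence is used.\<close>
  have lim0: "(\<lambda>n. (busy_step ^^ n) f x) \<longlonglongrightarrow> 0" for x
  proof (rule tendsto_sandwich[where f="\<lambda>_. 0" and h="\<lambda>n. ennreal (contraction ^ n) * weight x"])
    show "\<forall>\<^sub>F n in sequentially. (busy_step ^^ n) f x \<le> ennreal (contraction ^ n) * weight x"
      by (intro always_eventually allI order.trans[OF busy_step_pow_mono busy_step_pow_weight] order.trans[OF f busy_ind_le_weight])
    have "(\<lambda>n. ennreal (contraction ^ n)) \<longlonglongrightarrow> ennreal 0"
      using contraction_pos contraction_less_1 by (intro tendsto_ennrealI LIMSEQ_power_zero) auto
    then show "(\<lambda>n. ennreal (contraction ^ n) * weight x) \<longlonglongrightarrow> 0"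
      using tendsto_mult_ennreal[of "\<lambda>n. ennreal (contraction ^ n)" 0 sequentially "\<lambda>_. weight x" "weight x"] by (simp add: weight_def)
  qed auto
  have "(\<lambda>n. \<integral>\<^sup>+x. (busy_step ^^ n) f x \<partial>measure_pmf \<pi>) \<longlonglongrightarrow> (\<integral>\<^sup>+x. 0 \<partial>measure_pmf \<pi>)"
    by (rule nn_integral_dominated_convergence[where w="\<lambda>_. 1"]) (auto simp: bound lim0)
  moreover have "(\<lambda>n. \<Sum>k<n. entry ((busy_step ^^ k) f)) \<longlonglongrightarrow> excursion f"
    unfolding excursion_def by (intro summable_LIMSEQ) auto
  moreover have "?k < \<infinity>"
    by (simp add: ennreal_mult_less_top measure_pmf.emeasure_eq_measure)
  ultimately have "(\<lambda>n. (\<integral>\<^sup>+x. (busy_step ^^ n) f x \<partial>measure_pmf \<pi>) + ?k * (\<Sum>k<n. entry ((busy_step ^^ k) f))) \<longlonglongrightarrow> 0 + ?k * excursion f"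
    by (intro tendsto_add ennreal_tendsto_cmult) auto
  then show ?thesis
    unfolding it[symmetric] by (simp add: LIMSEQ_const_iff)
qed

text \<open>Integrating \<open>busy_ind\<close> makes 1 - P a fixed finite multiple of P, the
  probability of an empty system. This determines P, then the masses of all busy states, and finally
  those of \<open>vacant s\<close> through the balance with \<open>single s\<close>.\<close>

lemma stationary_unique:
  assumes st: "stationary lam mu p \<pi>" "stationary lam mu p \<pi>'"
  shows "\<pi> = \<pi>'"
proof -
  define P where "P \<pi> = measure (measure_pmf \<pi>) {x. \<not> busy x}" for \<pi>
  obtain g where g: "0 \<le> g" "excursion busy_ind = ennreal g"
    using excursion_busy_ind_finite by (cases "excursion busy_ind") auto
  have P: "1 - P \<pi> = lam / (lam + mu) * P \<pi> * g" if "stationary lam mu p \<pi>" for \<pi>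
  proof -
    have "(\<integral>\<^sup>+x. busy_ind x \<partial>measure_pmf \<pi>) = (\<integral>\<^sup>+x. indicator (UNIV - {x. \<not> busy x}) x \<partial>measure_pmf \<pi>)"
      by (intro nn_integral_cong) (auto simp: busy_ind_def)
    also have "\<dots> = ennreal (1 - P \<pi>)"
      unfolding P_def by (subst nn_integral_indicator) (auto simp: measure_pmf.emeasure_eq_measure measure_pmf.prob_compl[simplified, symmetric])
    finally have "ennreal (1 - P \<pi>) = ennreal (lam / (lam + mu)) * ennreal (P \<pi>) * ennreal g"
      using stationary_eq_excursion[OF that, of busy_ind] g by (simp add: measure_pmf.emeasure_eq_measure P_def)
    also have "\<dots> = ennreal (lam / (lam + mu) * P \<pi> * g)"
      using g lam_pos mu_pos
      by (simp add: ennreal_mult P_def del: times_divide_eq_left times_divide_eq_right)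
    finally have "ennreal (1 - P \<pi>) = ennreal (lam / (lam + mu) * P \<pi> * g)" .
    then show ?thesis
      using g lam_pos mu_pos by (subst (asm) ennreal_inj) (auto simp: P_def)
  qed
  obtain k where k: "k = lam / (lam + mu)"
    by simp
  have "(P \<pi> - P \<pi>') * (1 + lam / (lam + mu) * g) = 0"
    using P[OF st(1), folded k] P[OF st(2), folded k] unfolding k[symmetric] by (simp add: algebra_simps)
  moreover have "1 + lam / (lam + mu) * g > 0"
    using g lam_pos mu_pos by (intro add_pos_nonneg) auto
  ultimately have PP: "P \<pi> = P \<pi>'"
    by simp
  have busy: "pmf \<pi> y = pmf \<pi>' y" if "busy y" for y
  proof -
    have "ennreal (pmf \<rho> y) = ennreal (lam / (lam + mu)) * ennreal (P \<rho>) * excursion (indicator {y})"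
      if "stationary lam mu p \<rho>" for \<rho>
    proof -
      have "indicator {y} x \<le> busy_ind x" for x
        using \<open>busy y\<close> by (auto simp: busy_ind_def indicator_def)
      then show ?thesis
        using stationary_eq_excursion[OF that, of "indicator {y}"]
        by (simp add: emeasure_pmf_single P_def measure_pmf.emeasure_eq_measure[of _ "{x. \<not> busy x}"])
    qed
    then have "ennreal (pmf \<pi> y) = ennreal (pmf \<pi>' y)"
      using st PP by simp
    then show ?thesis
      by simp
  qed
  have vac: "pmf \<pi> (vacant s) = pmf \<pi>' (vacant s)" for s
  proof -
    have "ennreal (pmf \<rho> (vacant s)) * ennreal lam = ennreal mu * ennreal (pmf \<rho> (single s))"
      if "stationary lam mu p \<rho>" for \<rho>
      using that[unfolded stationary_point_iff, rule_format, of "vacant s"]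
      unfolding jumps_indicator_vacant[of s, THEN ext]
      by (simp add: nn_integral_cmult emeasure_pmf_single exit_rate_def)
    then have "ennreal (pmf \<pi> (vacant s)) * ennreal lam = ennreal (pmf \<pi>' (vacant s)) * ennreal lam"
      using st busy[of "single s"] by simp
    then show ?thesis
      using lam_pos by (simp add: ennreal_mult[symmetric])
  qed
  have uns: "pmf \<rho> y = 0" if "\<not> legit y" "stationary lam mu p \<rho>" for y \<rho>
    using stationary_legit[OF that(2)] that(1) by (auto simp: AE_measure_pmf_iff set_pmf_iff)
  show ?thesis
  proof (rule pmf_eqI)
    fix y
    consider "busy y" | s where "y = vacant s" | "\<not> legit y"
      unfolding legit_def by blast
    then show "pmf \<pi> y = pmf \<pi>' y"
      by cases (simp_all add: busy vac uns st)
  qed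
qed

lemma stationary_steady_state: "stationary lam mu p (steady_state lam mu p)"
  and steady_state_tail: "(\<integral>\<^sup>+x. ennreal (z ^ customers x) \<partial>measure_pmf (steady_state lam mu p)) < \<infinity>"
proof -
  obtain \<pi> where \<pi>: "stationary lam mu p \<pi>" "(\<integral>\<^sup>+x. ennreal (z ^ customers x) \<partial>measure_pmf \<pi>) < \<infinity>"
    by (rule stationary_exists)
  moreover have "steady_state lam mu p = \<pi>"
    unfolding steady_state_def by (rule the_equality) (auto intro: \<pi>(1) stationary_unique)
  ultimately show "stationary lam mu p (steady_state lam mu p)"
    "(\<integral>\<^sup>+x. ennreal (z ^ customers x) \<partial>measure_pmf (steady_state lam mu p)) < \<infinity>"
    by auto
qed

end

section \<open>Expected cost along the jump chain\<close>

lemma prob_space_exponential: "0 < l \<Longrightarrow> prob_space (exponential l)"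
  unfolding exponential_def by (rule prob_space_exponential_density)

lemma sets_exponential [simp, measurable_cong]: "sets (exponential l) = sets borel"
  by (simp add: exponential_def)

lemma nn_integral_exponential:
  assumes [measurable]: "f \<in> borel_measurable borel" and "0 < l"
  shows "(\<integral>\<^sup>+x. f x \<partial>exponential l) = (\<integral>\<^sup>+x. ennreal (exponential_density l x) * f x \<partial>lborel)"
  unfolding exponential_def using assms by (subst nn_integral_density) auto

lemma AE_exponential_nonneg: "0 < l \<Longrightarrow> AE x in exponential l. 0 \<le> x"
  unfolding exponential_def by (subst AE_density) (auto simp: exponential_density_def)

lemma nn_integral_exponential_mean:
  assumes "0 < l"
  shows "(\<integral>\<^sup>+x. ennreal x \<partial>exponential l) = ennreal (1 / l)"
proof -
  have "(\<integral>\<^sup>+x. ennreal x \<partial>exponential l) = (\<integral>\<^sup>+x. ennreal (exponential_density l x * x ^ 1) \<partial>lborel)"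
    using assms by (subst nn_integral_exponential)
      (auto simp: exponential_density_def ennreal_mult' ennreal_neg intro!: nn_integral_cong)
  also have "\<dots> = ennreal (1 / l)"
    using assms by (subst nn_integral_erlang_ith_moment) auto
  finally show ?thesis .
qed

text \<open>Substitute b = a + t: the density at a + t is exp (- u * a) times the density at
  t.\<close>

lemma nn_integral_exponential_residual_le:
  assumes [measurable]: "h \<in> borel_measurable borel" and "0 < u" "0 \<le> a"
  shows "(\<integral>\<^sup>+b. (if a \<le> b then h (b - a) else 0) \<partial>exponential u) =
    ennreal (exp (- (u * a))) * (\<integral>\<^sup>+b. h b \<partial>exponential u)"
proof -
  have "(\<integral>\<^sup>+b. (if a \<le> b then h (b - a) else 0) \<partial>exponential u) =
      (\<integral>\<^sup>+b. ennreal (exponential_density u b) * (if a \<le> b then h (b - a) else 0) \<partial>lborel)"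
    using assms by (intro nn_integral_exponential) measurable
  also have "\<dots> = (\<integral>\<^sup>+t. ennreal (exponential_density u (a + 1 * t)) * (if a \<le> a + 1 * t then h (a + 1 * t - a) else 0) \<partial>lborel)"
    by (subst nn_integral_real_affine[where c=1 and t=a]) auto
  also have "\<dots> = (\<integral>\<^sup>+t. ennreal (exp (- (u * a))) * (ennreal (exponential_density u t) * h t) \<partial>lborel)"
  proof (rule nn_integral_cong)
    fix t
    have "exp ((- a - t) * u) = exp (- (u * a)) * exp (- (t * u))"
      by (simp add: exp_add[symmetric] algebra_simps)
    then have "0 \<le> t \<Longrightarrow> exponential_density u (a + t) = exp (- (u * a)) * exponential_density u t"
      using assms by (simp add: exponential_density_def)
    then show "ennreal (exponential_density u (a + 1 * t)) * (if a \<le> a + 1 * t then h (a + 1 * t - a) else 0) =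
        ennreal (exp (- (u * a))) * (ennreal (exponential_density u t) * h t)"
      using assms by (cases "0 \<le> t")
        (auto simp: ennreal_mult exponential_density_nonneg mult.assoc, simp add: exponential_density_def)
  qed
  also have "\<dots> = ennreal (exp (- (u * a))) * (\<integral>\<^sup>+b. h b \<partial>exponential u)"
    using assms by (subst nn_integral_cmult) (auto simp: nn_integral_exponential)
  finally show ?thesis .
qed

text \<open>Ties between clocks are negligible. \<open>cost_upto\<close> treats a tie as a service
  completion, so strict and weak comparisons both occur.\<close>

lemma AE_exponential_neq: "AE b in exponential u. b \<noteq> (a :: real)"
  unfolding exponential_def by (subst AE_density) (auto intro: AE_mp[OF AE_lborel_singleton[of a]])

lemma nn_integral_exponential_residual:
  assumes [measurable]: "h \<in> borel_measurable borel" and "0 < u" "0 \<le> a"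
  shows "(\<integral>\<^sup>+b. (if a < b then h (b - a) else 0) \<partial>exponential u) =
    ennreal (exp (- (u * a))) * (\<integral>\<^sup>+b. h b \<partial>exponential u)"
proof -
  have "(\<integral>\<^sup>+b. (if a < b then h (b - a) else 0) \<partial>exponential u) =
      (\<integral>\<^sup>+b. (if a \<le> b then h (b - a) else 0) \<partial>exponential u)"
    using AE_exponential_neq[of a u] by (intro nn_integral_cong_AE) (auto elim!: eventually_mono)
  then show ?thesis
    using nn_integral_exponential_residual_le[of h u a] assms by simp
qed

text \<open>Exponential tilting: the factor exp (- u * a) turns the density of rate l into l / (l +
  u) times that of rate l + u. The value is the probability that the clock of rate l rings
  first.\<close>

lemma nn_integral_exponential_laplace:
  assumes "0 < l" "0 < u"
  shows "(\<integral>\<^sup>+a. ennreal (exp (- (u * a))) \<partial>exponential l) = ennreal (l / (l + u))"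
proof -
  interpret E: prob_space "exponential (l + u)"
    using assms by (intro prob_space_exponential) auto
  have "(\<integral>\<^sup>+a. ennreal (exp (- (u * a))) \<partial>exponential l) =
      (\<integral>\<^sup>+a. ennreal (l / (l + u)) * (ennreal (exponential_density (l + u) a) * 1) \<partial>lborel)"
  proof (subst nn_integral_exponential, simp, fact, rule nn_integral_cong)
    fix a
    have "exp (- (a * (l + u))) = exp (- (a * l)) * exp (- (u * a))"
      by (simp add: exp_add[symmetric] algebra_simps)
    then have "exponential_density l a * exp (- (u * a)) = l / (l + u) * exponential_density (l + u) a"
      using assms by (simp add: exponential_density_def)
    then show "ennreal (exponential_density l a) * ennreal (exp (- (u * a))) =
        ennreal (l / (l + u)) * (ennreal (exponential_density (l + u) a) * 1)"
      using assms by (simp add: ennreal_mult[symmetric] exponential_density_nonneg del: times_divide_eq_left)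
  qed
  also have "\<dots> = ennreal (l / (l + u)) * (\<integral>\<^sup>+a. 1 \<partial>exponential (l + u))"
    using assms nn_integral_exponential[of "\<lambda>_. 1" "l + u"] by (subst nn_integral_cmult) auto
  finally show ?thesis
    by (simp add: E.emeasure_space_1[simplified])
qed

text \<open>The residual time of the losing clock is independent of the winning time and again
  exponential, so the probability of winning factors out.\<close>

lemma exponential_race:
  assumes [measurable]: "h \<in> borel_measurable borel" and "0 < l" "0 < u"
  shows "(\<integral>\<^sup>+a. \<integral>\<^sup>+b. (if a < b then h (b - a) else 0) \<partial>exponential u \<partial>exponential l) =
    ennreal (l / (l + u)) * (\<integral>\<^sup>+b. h b \<partial>exponential u)" (is ?lt)
  and "(\<integral>\<^sup>+a. \<integral>\<^sup>+b. (if a \<le> b then h (b - a) else 0) \<partial>exponential u \<partial>exponential l) =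
    ennreal (l / (l + u)) * (\<integral>\<^sup>+b. h b \<partial>exponential u)" (is ?le)
proof -
  have "(\<integral>\<^sup>+a. \<integral>\<^sup>+b. (if a < b then h (b - a) else 0) \<partial>exponential u \<partial>exponential l) =
      (\<integral>\<^sup>+a. ennreal (exp (- (u * a))) * (\<integral>\<^sup>+b. h b \<partial>exponential u) \<partial>exponential l)"
    using AE_exponential_nonneg[OF \<open>0 < l\<close>] assms
    by (intro nn_integral_cong_AE) (auto elim!: eventually_mono simp: nn_integral_exponential_residual)
  then show ?lt
    using assms by (simp add: nn_integral_multc nn_integral_exponential_laplace)
  have "(\<integral>\<^sup>+a. \<integral>\<^sup>+b. (if a \<le> b then h (b - a) else 0) \<partial>exponential u \<partial>exponential l) =
      (\<integral>\<^sup>+a. ennreal (exp (- (u * a))) * (\<integral>\<^sup>+b. h b \<partial>exponential u) \<partial>exponential l)"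
    using AE_exponential_nonneg[OF \<open>0 < l\<close>] assms
    by (intro nn_integral_cong_AE) (auto elim!: eventually_mono simp: nn_integral_exponential_residual_le)
  then show ?le
    using assms by (simp add: nn_integral_multc nn_integral_exponential_laplace)
qed

lemma exponential_race':
  assumes h [measurable]: "h \<in> borel_measurable borel" and "0 < l" "0 < u"
  shows "(\<integral>\<^sup>+a. \<integral>\<^sup>+b. (if b \<le> a then h (a - b) else 0) \<partial>exponential u \<partial>exponential l) =
    ennreal (u / (l + u)) * (\<integral>\<^sup>+a. h a \<partial>exponential l)"
proof -
  interpret L: prob_space "exponential l" by (rule prob_space_exponential) fact
  interpret U: prob_space "exponential u" by (rule prob_space_exponential) fact
  interpret P: pair_sigma_finite "exponential l" "exponential u" ..
  have "(\<integral>\<^sup>+a. \<integral>\<^sup>+b. (if b \<le> a then h (a - b) else 0) \<partial>exponential u \<partial>exponential l) =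
      (\<integral>\<^sup>+b. \<integral>\<^sup>+a. (if b \<le> a then h (a - b) else 0) \<partial>exponential l \<partial>exponential u)"
    by (rule P.Fubini'[symmetric]) measurable
  then show ?thesis
    using exponential_race(2)[OF h \<open>0 < u\<close> \<open>0 < l\<close>] by (simp add: add.commute)
qed

text \<open>For nonnegative times, a is min a b plus the positive part of a - b, whose mean is u /
  (l + u) * (1 / l) by the race formula. The known mean of a then leaves the mean of the minimum
  after cancelling a finite term.\<close>

lemma exponential_min:
  assumes "0 < l" "0 < u"
  shows "(\<integral>\<^sup>+a. \<integral>\<^sup>+b. ennreal (min a b) \<partial>exponential u \<partial>exponential l) = ennreal (1 / (l + u))"
proof -
  interpret L: prob_space "exponential l" by (rule prob_space_exponential) fact
  interpret U: prob_space "exponential u" by (rule prob_space_exponential) fact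
  let ?M = "\<integral>\<^sup>+a. \<integral>\<^sup>+b. ennreal (min a b) \<partial>exponential u \<partial>exponential l"
  have "ennreal (1 / l) = (\<integral>\<^sup>+a. \<integral>\<^sup>+b. ennreal a \<partial>exponential u \<partial>exponential l)"
    using assms by (simp add: nn_integral_exponential_mean U.emeasure_space_1[simplified])
  also have "\<dots> = (\<integral>\<^sup>+a. \<integral>\<^sup>+b. ennreal (min a b) + (if b \<le> a then ennreal (a - b) else 0) \<partial>exponential u \<partial>exponential l)"
  proof (intro nn_integral_cong_AE, rule eventually_mono[OF AE_exponential_nonneg[OF \<open>0 < l\<close>]], intro nn_integral_cong_AE, rule eventually_mono[OF AE_exponential_nonneg[OF \<open>0 < u\<close>]])
    fix a b :: real assume "0 \<le> a" "0 \<le> b"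
    then show "ennreal a = ennreal (min a b) + (if b \<le> a then ennreal (a - b) else 0)"
      by (auto simp: min_def ennreal_plus[symmetric] simp del: ennreal_plus)
  qed
  also have "\<dots> = ?M + ennreal (u / (l + u)) * ennreal (1 / l)"
    using assms by (simp add: nn_integral_add exponential_race' nn_integral_exponential_mean)
  finally have *: "ennreal (1 / l) = ?M + ennreal (u / (l + u)) * ennreal (1 / l)" .
  have "l + u \<noteq> 0"
    using assms by simp
  then have "1 / l = 1 / (l + u) + u / (l + u) * (1 / l)"
    using assms by (simp add: divide_simps)
  then have "ennreal (1 / l) = ennreal (1 / (l + u) + u / (l + u) * (1 / l))"
    by (rule arg_cong)
  also have "\<dots> = ennreal (1 / (l + u)) + ennreal (u / (l + u) * (1 / l))"
    using assms by (intro ennreal_plus) auto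
  also have "ennreal (u / (l + u) * (1 / l)) = ennreal (u / (l + u)) * ennreal (1 / l)"
    using assms by (intro ennreal_mult) auto
  finally have "ennreal (u / (l + u)) * ennreal (1 / l) + ?M = ennreal (u / (l + u)) * ennreal (1 / l) + ennreal (1 / (l + u))"
    using * by (metis add.commute)
  moreover have "ennreal (u / (l + u)) * ennreal (1 / l) \<noteq> \<infinity>"
    by (simp add: ennreal_mult_eq_top_iff)
  ultimately show ?thesis
    unfolding ennreal_add_left_cancel by blast
qed

section \<open>Integration over the arrival and service streams\<close>

locale race = fixes lam mu p :: real assumes lam_pos: "lam > 0" and mu_pos: "mu > 0"
begin

sublocale X: prob_space "exponential lam" by (rule prob_space_exponential[OF lam_pos])
sublocale B: prob_space "exponential mu" by (rule prob_space_exponential[OF mu_pos])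
sublocale XQ: pair_prob_space "exponential lam" "measure_pmf (route p)" ..
sublocale SA: prob_space "arrivals lam p"
  unfolding arrivals_def by (rule XQ.prob_space_stream_space)
sublocale SB: prob_space "services mu"
  unfolding services_def by (rule B.prob_space_stream_space)
sublocale SAB: pair_sigma_finite "arrivals lam p" "services mu" ..
sublocale SAb: pair_sigma_finite "arrivals lam p" "exponential mu" ..

abbreviation AS where "AS \<equiv> stream_space (borel \<Otimes>\<^sub>M count_space UNIV) :: (real \<times> queue) stream measure"
abbreviation BS where "BS \<equiv> stream_space borel :: real stream measure"

lemma sets_arrivals [simp, measurable_cong]: "sets (arrivals lam p) = sets AS"
  unfolding arrivals_def by (intro sets_stream_space_cong sets_pair_measure_cong) auto

lemma sets_services [simp, measurable_cong]: "sets (services mu) = sets BS"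
  unfolding services_def by (intro sets_stream_space_cong) auto

lemma space_AS [simp]: "space AS = UNIV"
  by (simp add: space_stream_space space_pair_measure)

lemma space_arrivals [simp]: "space (arrivals lam p) = UNIV"
  using sets_eq_imp_space_eq[OF sets_arrivals] by simp

lemma measurable_section:
  assumes "case_prod F \<in> borel_measurable (AS \<Otimes>\<^sub>M BS)"
  shows "F as \<in> borel_measurable BS"
  using measurable_Pair2[OF assms, of as] by simp

lemma nn_integral_services:
  assumes [measurable]: "f \<in> borel_measurable BS"
  shows "(\<integral>\<^sup>+bs. f bs \<partial>services mu) = (\<integral>\<^sup>+b. \<integral>\<^sup>+bs. f (b ## bs) \<partial>services mu \<partial>exponential mu)"
  unfolding services_def by (rule B.nn_integral_stream_space) measurable

lemma nn_integral_route: "(\<integral>\<^sup>+r. f r \<partial>measure_pmf (route p)) = (\<Sum>r\<in>UNIV. ennreal (pmf (route p) r) * f r)"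
  by (simp add: nn_integral_measure_pmf nn_integral_count_space_finite)

lemma nn_integral_arrival:
  assumes [measurable]: "f \<in> borel_measurable (borel \<Otimes>\<^sub>M count_space UNIV)"
  shows "(\<integral>\<^sup>+y. f y \<partial>(exponential lam \<Otimes>\<^sub>M measure_pmf (route p))) =
    (\<Sum>r\<in>UNIV. ennreal (pmf (route p) r) * (\<integral>\<^sup>+a. f (a, r) \<partial>exponential lam))"
  by (subst measure_pmf.nn_integral_fst[symmetric])
     (auto simp: nn_integral_route nn_integral_sum nn_integral_cmult)

text \<open>Both heads are brought outside both tails, so that the race of the first two clocks can
  be evaluated. This needs one exchange, of the first service time with the tail of the arrival
  stream.\<close>

lemma nn_integral_streams:
  assumes F [measurable]: "case_prod F \<in> borel_measurable (AS \<Otimes>\<^sub>M BS)"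
  shows "(\<integral>\<^sup>+as. \<integral>\<^sup>+bs. F as bs \<partial>services mu \<partial>arrivals lam p) =
    (\<Sum>r\<in>UNIV. ennreal (pmf (route p) r) * (\<integral>\<^sup>+a. \<integral>\<^sup>+b. \<integral>\<^sup>+as. \<integral>\<^sup>+bs. F ((a, r) ## as) (b ## bs)
      \<partial>services mu \<partial>arrivals lam p \<partial>exponential mu \<partial>exponential lam))"
proof -
  have "(\<integral>\<^sup>+as. \<integral>\<^sup>+bs. F as bs \<partial>services mu \<partial>arrivals lam p) =
      (\<integral>\<^sup>+y. \<integral>\<^sup>+as. \<integral>\<^sup>+bs. F (y ## as) bs \<partial>services mu \<partial>arrivals lam p \<partial>(exponential lam \<Otimes>\<^sub>M measure_pmf (route p)))"
    unfolding arrivals_def by (rule XQ.nn_integral_stream_space) measurable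
  also have "\<dots> = (\<integral>\<^sup>+y. \<integral>\<^sup>+as. \<integral>\<^sup>+b. \<integral>\<^sup>+bs. F (y ## as) (b ## bs) \<partial>services mu \<partial>exponential mu
      \<partial>arrivals lam p \<partial>(exponential lam \<Otimes>\<^sub>M measure_pmf (route p)))"
    by (intro nn_integral_cong nn_integral_services measurable_section[OF F])
  also have "\<dots> = (\<integral>\<^sup>+y. \<integral>\<^sup>+b. \<integral>\<^sup>+as. \<integral>\<^sup>+bs. F (y ## as) (b ## bs) \<partial>services mu \<partial>arrivals lam p
      \<partial>exponential mu \<partial>(exponential lam \<Otimes>\<^sub>M measure_pmf (route p)))"
  proof (rule nn_integral_cong, rule SAb.Fubini'[symmetric])
    fix y :: "real \<times> queue"
    have [measurable]: "(\<lambda>x. y) \<in> N \<rightarrow>\<^sub>M borel \<Otimes>\<^sub>M count_space UNIV" for N :: "'z measure"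
      by (rule measurable_const) (simp add: space_pair_measure)
    show "(\<lambda>(as, b). \<integral>\<^sup>+bs. F (y ## as) (b ## bs) \<partial>services mu) \<in> borel_measurable (arrivals lam p \<Otimes>\<^sub>M exponential mu)"
      by measurable
  qed
  also have "\<dots> = (\<Sum>r\<in>UNIV. ennreal (pmf (route p) r) * (\<integral>\<^sup>+a. \<integral>\<^sup>+b. \<integral>\<^sup>+as. \<integral>\<^sup>+bs. F ((a, r) ## as) (b ## bs)
      \<partial>services mu \<partial>arrivals lam p \<partial>exponential mu \<partial>exponential lam))"
    by (rule nn_integral_arrival) measurable
  finally show ?thesis .
qed

text \<open>By the memoryless property the residual of the clock that did not ring is again a fresh
  exponential time.\<close>

lemma nn_integral_first_event:
  fixes F :: "queue \<Rightarrow> (real \<times> queue) stream \<Rightarrow> real stream \<Rightarrow> ennreal"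
  assumes F [measurable]: "\<And>r. case_prod (F r) \<in> borel_measurable (AS \<Otimes>\<^sub>M BS)"
    and F' [measurable]: "case_prod F' \<in> borel_measurable (AS \<Otimes>\<^sub>M BS)"
  shows "(\<integral>\<^sup>+as. \<integral>\<^sup>+bs. ennreal k * ennreal (min (fst (shd as)) (shd bs)) +
      (if fst (shd as) < shd bs
       then (if snd (shd as) = Q1 then F Q1 (stl as) ((shd bs - fst (shd as)) ## stl bs)
             else F Q2 (stl as) ((shd bs - fst (shd as)) ## stl bs))
       else F' ((fst (shd as) - shd bs, snd (shd as)) ## stl as) (stl bs)) \<partial>services mu \<partial>arrivals lam p) =
    ennreal k * ennreal (1 / (lam + mu)) +
    ennreal (lam / (lam + mu)) * (\<Sum>r\<in>UNIV. ennreal (pmf (route p) r) * (\<integral>\<^sup>+as. \<integral>\<^sup>+bs. F r as bs \<partial>services mu \<partial>arrivals lam p)) +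
    ennreal (mu / (lam + mu)) * (\<integral>\<^sup>+as. \<integral>\<^sup>+bs. F' as bs \<partial>services mu \<partial>arrivals lam p)"
proof -
  \<comment> \<open>In \<open>H r t\<close> an arrival has just joined r and t is the residual
    service time. In \<open>K r t\<close> a service has just ended and t is the time left until the
    pending arrival, which keeps its queue r.\<close>
  define H where "H r t = (\<integral>\<^sup>+as. \<integral>\<^sup>+bs. F r as (t ## bs) \<partial>services mu \<partial>arrivals lam p)" for r t
  define K where "K r t = (\<integral>\<^sup>+as. \<integral>\<^sup>+bs. F' ((t, r) ## as) bs \<partial>services mu \<partial>arrivals lam p)" for r t
  have [measurable]: "H r \<in> borel_measurable borel" for r
    unfolding H_def by measurable
  have [measurable]: "K r \<in> borel_measurable borel" for r
    unfolding K_def by measurable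
  have H: "(\<integral>\<^sup>+b. H r b \<partial>exponential mu) = (\<integral>\<^sup>+as. \<integral>\<^sup>+bs. F r as bs \<partial>services mu \<partial>arrivals lam p)" for r
  proof -
    have "(\<integral>\<^sup>+b. H r b \<partial>exponential mu) = (\<integral>\<^sup>+as. \<integral>\<^sup>+b. \<integral>\<^sup>+bs. F r as (b ## bs) \<partial>services mu \<partial>exponential mu \<partial>arrivals lam p)"
      unfolding H_def by (rule SAb.Fubini') measurable
    also have "\<dots> = (\<integral>\<^sup>+as. \<integral>\<^sup>+bs. F r as bs \<partial>services mu \<partial>arrivals lam p)"
      by (intro nn_integral_cong nn_integral_services[symmetric] measurable_section[OF F])
    finally show ?thesis .
  qed
  have K: "(\<Sum>r\<in>UNIV. ennreal (pmf (route p) r) * (\<integral>\<^sup>+a. K r a \<partial>exponential lam)) =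
      (\<integral>\<^sup>+as. \<integral>\<^sup>+bs. F' as bs \<partial>services mu \<partial>arrivals lam p)"
  proof -
    have "(\<integral>\<^sup>+as. \<integral>\<^sup>+bs. F' as bs \<partial>services mu \<partial>arrivals lam p) =
        (\<integral>\<^sup>+y. \<integral>\<^sup>+as. \<integral>\<^sup>+bs. F' (y ## as) bs \<partial>services mu \<partial>arrivals lam p \<partial>(exponential lam \<Otimes>\<^sub>M measure_pmf (route p)))"
      unfolding arrivals_def by (rule XQ.nn_integral_stream_space) measurable
    also have "\<dots> = (\<Sum>r\<in>UNIV. ennreal (pmf (route p) r) * (\<integral>\<^sup>+a. K r a \<partial>exponential lam))"
      unfolding K_def by (rule nn_integral_arrival) measurable
    finally show ?thesis ..
  qed
  have inner: "(\<integral>\<^sup>+as. \<integral>\<^sup>+bs. ennreal k * ennreal (min a b) +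
      (if a < b then (if r = Q1 then F Q1 as ((b - a) ## bs) else F Q2 as ((b - a) ## bs))
       else F' ((a - b, r) ## as) bs) \<partial>services mu \<partial>arrivals lam p) =
     ennreal k * ennreal (min a b) + (if a < b then H r (b - a) else 0) + (if b \<le> a then K r (a - b) else 0)" for a b r
    by (cases r) (auto simp: H_def K_def nn_integral_add SA.emeasure_space_1[simplified] SB.emeasure_space_1[simplified])
  have outer: "(\<integral>\<^sup>+a. \<integral>\<^sup>+b. ennreal k * ennreal (min a b) + (if a < b then H r (b - a) else 0) +
        (if b \<le> a then K r (a - b) else 0) \<partial>exponential mu \<partial>exponential lam) =
      ennreal k * ennreal (1 / (lam + mu)) + ennreal (lam / (lam + mu)) * (\<integral>\<^sup>+b. H r b \<partial>exponential mu) +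
      ennreal (mu / (lam + mu)) * (\<integral>\<^sup>+a. K r a \<partial>exponential lam)" for r
    using lam_pos mu_pos
    by (simp add: nn_integral_add nn_integral_cmult exponential_race exponential_race' exponential_min)
  have sum1: "(\<Sum>r\<in>UNIV. ennreal (pmf (route p) r)) = 1"
    using nn_integral_route[of "\<lambda>_. 1"] by (simp add: measure_pmf.emeasure_space_1[simplified])
  have step: "(\<Sum>r\<in>UNIV. ennreal (pmf (route p) r) * (e + (x * f r) + (y * g r))) =
      e + x * (\<Sum>r\<in>UNIV. ennreal (pmf (route p) r) * f r) + y * (\<Sum>r\<in>UNIV. ennreal (pmf (route p) r) * g r)"
    for e x y f g
  proof -
    have "(\<Sum>r\<in>UNIV. ennreal (pmf (route p) r) * (e + (x * f r) + (y * g r))) =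
        (\<Sum>r\<in>UNIV. ennreal (pmf (route p) r)) * e + x * (\<Sum>r\<in>UNIV. ennreal (pmf (route p) r) * f r) +
        y * (\<Sum>r\<in>UNIV. ennreal (pmf (route p) r) * g r)"
      by (simp only: distrib_left sum.distrib sum_distrib_left sum_distrib_right mult_ac)
    then show ?thesis
      by (simp only: sum1 mult_1)
  qed
  show ?thesis
    by (subst nn_integral_streams, measurable)
       (simp only: stream.sel fst_conv snd_conv inner outer H step K)
qed

section \<open>Expected cost over finitely many events\<close>

definition served :: "real \<Rightarrow> real \<Rightarrow> nat \<Rightarrow> state \<Rightarrow> queue \<Rightarrow> nat
    \<Rightarrow> (real \<times> queue) stream \<Rightarrow> real stream \<Rightarrow> ennreal" where
  "served c d m x i k as bs = (if fst x \<noteq> i then cost_upto c d m (serve x) i k as bs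
     else (case k of 0 \<Rightarrow> 0 | Suc k' \<Rightarrow> cost_upto c d m (serve x) i k' as bs))"

text \<open>Writing out both queues of the next arrival leaves in each branch one fixed function of
  the streams, the form that \<open>nn_integral_first_event\<close> expects.\<close>

lemma cost_upto_Suc:
  "cost_upto c d (Suc m) x i k as bs =
    ennreal (if fst x = i then c else d) * ennreal (min (fst (shd as)) (shd bs)) +
      (if fst (shd as) < shd bs
       then (if snd (shd as) = Q1 then cost_upto c d m (arrive Q1 x) i k (stl as) ((shd bs - fst (shd as)) ## stl bs)
             else cost_upto c d m (arrive Q2 x) i k (stl as) ((shd bs - fst (shd as)) ## stl bs))
       else served c d m x i k ((fst (shd as) - shd bs, snd (shd as)) ## stl as) (stl bs))"
  by (cases "shd as"; cases "snd (shd as)") (auto simp: served_def Let_def split: nat.split)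

lemma served_measurable:
  assumes "\<And>x k. case_prod (cost_upto c d m x i k) \<in> borel_measurable (AS \<Otimes>\<^sub>M BS)"
  shows "case_prod (served c d m x i k) \<in> borel_measurable (AS \<Otimes>\<^sub>M BS)"
  by (cases k; cases "fst x = i") (simp_all add: served_def[abs_def] assms split_def[abs_def] assms[unfolded split_def])

lemma cost_upto_measurable: "case_prod (cost_upto c d m x i k) \<in> borel_measurable (AS \<Otimes>\<^sub>M BS)"
proof (induction m arbitrary: x k)
  case 0
  show ?case
    by (simp add: split_def)
next
  case (Suc m)
  note [measurable] = Suc served_measurable[OF Suc]
  show ?case
    unfolding cost_upto_Suc by measurable
qed

text \<open>The expectation of \<open>cost_upto\<close>, as \<open>nn_integral_cost_upto\<close>
  shows: the next event takes 1 / (lam + mu) on average and is an arrival with probability lam /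
  (lam + mu).\<close>

fun mean_cost :: "real \<Rightarrow> real \<Rightarrow> nat \<Rightarrow> state \<Rightarrow> queue \<Rightarrow> nat \<Rightarrow> real" where
  "mean_cost c d 0 x i k = 0"
| "mean_cost c d (Suc m) x i k = (if fst x = i then c else d) * (1 / (lam + mu)) +
     lam / (lam + mu) * (\<Sum>r\<in>UNIV. pmf (route p) r * mean_cost c d m (arrive r x) i k) +
     mu / (lam + mu) * (if fst x \<noteq> i then mean_cost c d m (serve x) i k
       else (case k of 0 \<Rightarrow> 0 | Suc k' \<Rightarrow> mean_cost c d m (serve x) i k'))"

lemma mean_cost_nonneg:
  assumes "0 \<le> c" "0 \<le> d"
  shows "0 \<le> mean_cost c d m x i k"
proof (induction m arbitrary: x k)
  case (Suc m)
  have "0 \<le> mean_cost c d m y i l" for y l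
    by (rule Suc)
  then show ?case
    unfolding mean_cost.simps using assms lam_pos mu_pos
    by (intro add_nonneg_nonneg mult_nonneg_nonneg sum_nonneg) (auto split: nat.split simp del: split_paired_All)
qed simp

lemma nn_integral_cost_upto:
  assumes "0 \<le> c" "0 \<le> d"
  shows "(\<integral>\<^sup>+as. \<integral>\<^sup>+bs. cost_upto c d m x i k as bs \<partial>services mu \<partial>arrivals lam p) = ennreal (mean_cost c d m x i k)"
proof (induction m arbitrary: x k)
  case 0
  have "cost_upto c d 0 x i k = (\<lambda>_ _. 0)"
    by (intro ext) simp
  then show ?case
    by simp
next
  case (Suc m)
  have served: "(\<integral>\<^sup>+as. \<integral>\<^sup>+bs. served c d m x i k as bs \<partial>services mu \<partial>arrivals lam p) =
      ennreal (if fst x \<noteq> i then mean_cost c d m (serve x) i k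
       else (case k of 0 \<Rightarrow> 0 | Suc k' \<Rightarrow> mean_cost c d m (serve x) i k'))"
    unfolding served_def by (cases k) (auto simp: Suc)
  have "(\<integral>\<^sup>+as. \<integral>\<^sup>+bs. cost_upto c d (Suc m) x i k as bs \<partial>services mu \<partial>arrivals lam p) =
     ennreal (if fst x = i then c else d) * ennreal (1 / (lam + mu)) +
    ennreal (lam / (lam + mu)) * (\<Sum>r\<in>UNIV. ennreal (pmf (route p) r) * ennreal (mean_cost c d m (arrive r x) i k)) +
    ennreal (mu / (lam + mu)) * ennreal (if fst x \<noteq> i then mean_cost c d m (serve x) i k
       else (case k of 0 \<Rightarrow> 0 | Suc k' \<Rightarrow> mean_cost c d m (serve x) i k'))"
    unfolding cost_upto_Suc
    by (subst nn_integral_first_event[where F="\<lambda>r. cost_upto c d m (arrive r x) i k"])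
       (auto intro: cost_upto_measurable served_measurable[OF cost_upto_measurable] simp: Suc served)
  also have "(\<Sum>r\<in>UNIV. ennreal (pmf (route p) r) * ennreal (mean_cost c d m (arrive r x) i k)) =
      ennreal (\<Sum>r\<in>UNIV. pmf (route p) r * mean_cost c d m (arrive r x) i k)"
    using assms by (simp add: ennreal_mult[symmetric] mean_cost_nonneg sum_ennreal)
  also have "ennreal (if fst x = i then c else d) * ennreal (1 / (lam + mu)) +
    ennreal (lam / (lam + mu)) * ennreal (\<Sum>r\<in>UNIV. pmf (route p) r * mean_cost c d m (arrive r x) i k) +
    ennreal (mu / (lam + mu)) * ennreal (if fst x \<noteq> i then mean_cost c d m (serve x) i k
       else (case k of 0 \<Rightarrow> 0 | Suc k' \<Rightarrow> mean_cost c d m (serve x) i k')) = ennreal (mean_cost c d (Suc m) x i k)"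
  proof -
    have *: "ennreal a * ennreal a' + ennreal b * ennreal b' + ennreal e * ennreal e' = ennreal (a * a' + b * b' + e * e')"
      if "0 \<le> a" "0 \<le> a'" "0 \<le> b" "0 \<le> b'" "0 \<le> e" "0 \<le> e'" for a a' b b' e e'
      using that by (simp add: ennreal_mult[symmetric] ennreal_plus[symmetric] del: ennreal_plus)
    show ?thesis
      unfolding mean_cost.simps using assms lam_pos mu_pos
      by (intro *) (auto split: nat.split intro!: sum_nonneg mult_nonneg_nonneg mean_cost_nonneg)
  qed
  finally show ?case .
qed

end

section \<open>Cost of a tagged customer\<close>

lemma arrive_busy: "busy x \<Longrightarrow> arrive r x = (fst x, (snd x)(r := snd x r + 1))"
  by (cases x; cases "fst x"; cases r) (auto simp: busy_def arrive_def settle_def)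

lemma serve_busy: "busy x \<Longrightarrow> serve x =
    (if snd x (fst x) = 1 \<and> snd x (other (fst x)) > 0 then other (fst x) else fst x,
     (snd x)(fst x := snd x (fst x) - 1))"
  by (cases x; cases "fst x") (auto simp: busy_def serve_def settle_def)

lemma sum_queue_other: "(\<Sum>i\<in>UNIV. f i) = f s + f (other s :: queue)" for f :: "queue \<Rightarrow> 'a :: comm_monoid_add"
  by (cases s) (auto simp: sum_queue add.commute)

context race
begin

text \<open>Costs are nonnegative, so a longer horizon can only add to them. This makes monotone
  convergence applicable to the supremum in \<open>total_cost\<close>.\<close>

lemma incseq_cost_upto: "incseq (\<lambda>m. cost_upto c d m x i k as bs)"
proof (rule incseq_SucI)
  show "cost_upto c d m x i k as bs \<le> cost_upto c d (Suc m) x i k as bs" for m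
  proof (induction m arbitrary: x k as bs)
    case (Suc m)
    have "served c d m x i k as bs \<le> served c d (Suc m) x i k as bs" for as bs
      unfolding served_def by (cases k) (simp_all only: nat.case if_cancel Suc split: if_split, simp_all add: Suc del: cost_upto.simps)
    then show ?case
      unfolding cost_upto_Suc[of c d "Suc m" x i k as bs] cost_upto_Suc[of c d m x i k as bs]
      by (intro add_left_mono) (simp add: Suc del: cost_upto.simps)
  qed simp
qed

end

text \<open>Invariant up to the departure of the tagged customer. Her presence keeps queue
  \<open>i\<close> nonempty, so the server moves there once the other queue is exhausted.\<close>

definition tagged :: "state \<Rightarrow> queue \<Rightarrow> nat \<Rightarrow> bool" where
  "tagged x i k \<longleftrightarrow> busy x \<and> k < snd x i"

lemma tagged_arrive: "tagged x i k \<Longrightarrow> tagged (arrive r x) i k"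
  by (auto simp: tagged_def busy_arrive) (auto simp: arrive_busy)

lemma tagged_serve_other: "tagged x i k \<Longrightarrow> fst x \<noteq> i \<Longrightarrow> tagged (serve x) i k"
  by (auto simp: tagged_def serve_busy queue_neq) (auto simp: busy_def)

lemma tagged_serve_own: "tagged x i (Suc k) \<Longrightarrow> fst x = i \<Longrightarrow> tagged (serve x) i k"
  by (auto simp: tagged_def serve_busy) (auto simp: busy_def)

context polling
begin

sublocale race lam mu p
  by unfold_locales (rule lam_pos, rule mu_pos)

section \<open>Closed form of the cost and geometric convergence to it\<close>

lemma queue_rate_le: "queue_rate i \<le> lam"
proof -
  have "queue_rate Q1 \<le> lam" "queue_rate Q2 \<le> lam"
    using queue_rate_nonneg[of Q1] queue_rate_nonneg[of Q2] queue_rate_sum by linarith+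
  then show ?thesis
    by (cases i) simp_all
qed

lemma queue_rate_less: "queue_rate i < mu"
  using queue_rate_le[of i] lam_mu by linarith

lemma sum_queue_rate: "queue_rate s + queue_rate (other s) = lam"
  using queue_rate_sum by (cases s) auto

lemma queue_rate_split: "queue_rate s * v + queue_rate (other s) * v = lam * v"
  by (simp only: distrib_right[symmetric] sum_queue_rate)

definition sojourn_cost :: "real \<Rightarrow> real \<Rightarrow> state \<Rightarrow> queue \<Rightarrow> nat \<Rightarrow> real" where
  "sojourn_cost c d x i k = c * (real k + 1) / mu +
     (if fst x = i then 0 else d * real (snd x (fst x)) / (mu - queue_rate (fst x)))"

text \<open>Geometric in the number of service completions that are known to precede the end of the sojourn.\<close>

definition wait_weight :: "state \<Rightarrow> queue \<Rightarrow> nat \<Rightarrow> real" where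
  "wait_weight x i k = z ^ Suc k * (if fst x = i then 1 else z ^ snd x (fst x))"

text \<open>One jump of the tagged chain with rates in place of probabilities, killed at the tagged
  customer's own service completion.\<close>

definition flow :: "(state \<Rightarrow> queue \<Rightarrow> nat \<Rightarrow> real) \<Rightarrow> state \<Rightarrow> queue \<Rightarrow> nat \<Rightarrow> real" where
  "flow g x i k = (\<Sum>r\<in>UNIV. queue_rate r * g (arrive r x) i k) +
     mu * (if fst x \<noteq> i then g (serve x) i k else (case k of 0 \<Rightarrow> 0 | Suc k' \<Rightarrow> g (serve x) i k'))"

lemma mean_cost_flow:
  "(lam + mu) * mean_cost c d (Suc m) x i k = (if fst x = i then c else d) + flow (mean_cost c d m) x i k"
proof -
  have *: "L * (e * (1 / L) + lam / L * S + mu / L * N) = e + (lam * S + mu * N)" if "L \<noteq> 0" for e S N L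
    using that by (simp add: distrib_left)
  show ?thesis
    unfolding mean_cost.simps flow_def queue_rate_def mult.assoc sum_distrib_left[symmetric]
    using lam_pos mu_pos by (intro *) simp
qed

lemma flow_diff: "flow (\<lambda>x i k. f x i k - g x i k) x i k = flow f x i k - flow g x i k"
  by (simp add: flow_def sum_queue algebra_simps split: nat.split)

lemma flow_cmult: "flow (\<lambda>x i k. e * f x i k) x i k = e * flow f x i k"
  by (simp add: flow_def sum_queue algebra_simps split: nat.split)

lemma flow_mono:
  assumes t: "tagged x i k" and le: "\<And>x k. tagged x i k \<Longrightarrow> f x i k \<le> g x i k"
  shows "flow f x i k \<le> flow g x i k"
proof -
  have "(case k of 0 \<Rightarrow> 0 | Suc k' \<Rightarrow> f (serve x) i k') \<le> (case k of 0 \<Rightarrow> 0 | Suc k' \<Rightarrow> g (serve x) i k')" if "fst x = i"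
  proof (cases k)
    case (Suc k')
    then have "tagged (serve x) i k'"
      using t that by (intro tagged_serve_own) simp_all
    then show ?thesis
      using Suc le by simp
  qed simp
  then show ?thesis
    unfolding flow_def using le[OF tagged_arrive[OF t]] le[OF tagged_serve_other[OF t]] mu_pos
    by (intro add_mono sum_mono mult_left_mono) auto
qed

text \<open>The first-step equation. Arrivals at queue \<open>i\<close> join behind the tagged
  customer and change nothing. While the server is away, the waiting term is d times the mean length
  of a busy period begun with n customers, and each arrival there prolongs it by 1 / (mu -
  queue_rate) on average.\<close>

lemma sojourn_cost_flow:
  assumes t: "tagged x i k"
  shows "(lam + mu) * sojourn_cost c d x i k = (if fst x = i then c else d) + flow (sojourn_cost c d) x i k"
proof (cases "fst x = i")
  case True
  have b: "busy x"
    using t by (simp add: tagged_def)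
  have "(\<Sum>r\<in>UNIV. queue_rate r * sojourn_cost c d (arrive r x) i k) = lam * (c * (real k + 1) / mu)"
    using True queue_rate_split[of i "c * (real k + 1) / mu"] by (simp add: sum_queue_other[of _ i] arrive_busy[OF b] sojourn_cost_def)
  moreover have "(case k of 0 \<Rightarrow> 0 | Suc k' \<Rightarrow> sojourn_cost c d (serve x) i k') = c * real k / mu"
    using True t by (auto simp: sojourn_cost_def serve_busy[OF b] tagged_def split: nat.split)
  ultimately show ?thesis
    using True mu_pos by (simp add: flow_def sojourn_cost_def field_simps)
next
  case False
  let ?n = "real (snd x (fst x))" and ?e = "mu - queue_rate (fst x)"
  have b: "busy x" and i: "i = other (fst x)"
    using t False by (auto simp: tagged_def queue_neq)
  have n: "snd x (fst x) > 0"
    using b by (simp add: busy_def)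
  let ?u = "c * (real k + 1) / mu" and ?v = "d * ?n / ?e" and ?j = "fst x"
  have "(\<Sum>r\<in>UNIV. queue_rate r * sojourn_cost c d (arrive r x) i k) = queue_rate ?j * (?u + d * (?n + 1) / ?e) + queue_rate (other ?j) * (?u + ?v)"
    using False by (simp add: sum_queue_other[of _ ?j] arrive_busy[OF b] sojourn_cost_def add.commute)
  also have "\<dots> = (queue_rate ?j * (?u + ?v) + queue_rate (other ?j) * (?u + ?v)) + queue_rate ?j * d / ?e"
    by (simp add: distrib_left add_divide_distrib)
  also have "\<dots> = lam * ?u + lam * ?v + queue_rate ?j * d / ?e"
    unfolding queue_rate_split by (simp only: distrib_left)
  finally have S: "(\<Sum>r\<in>UNIV. queue_rate r * sojourn_cost c d (arrive r x) i k) = lam * ?u + lam * ?v + queue_rate ?j * d / ?e" .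
  \<comment> \<open>If ?n = 1 the server switches to \<open>i\<close>, where no waiting term is
    left; d * (?n - 1) / ?e is then 0, so one formula covers both cases.\<close>
  have N: "sojourn_cost c d (serve x) i k = c * (real k + 1) / mu + d * (?n - 1) / ?e"
    using False n i by (auto simp: sojourn_cost_def serve_busy[OF b] of_nat_diff)
  have E: "queue_rate (fst x) * d / ?e + d + mu * (d * (?n - 1) / ?e) = mu * (d * ?n / ?e)"
  proof -
    have e: "?e \<noteq> 0"
      using queue_rate_less[of "fst x"] by simp
    have "d = d * ?e / ?e"
      using e by simp
    then have "queue_rate (fst x) * d / ?e + d + mu * (d * (?n - 1) / ?e) = (queue_rate (fst x) * d + d * ?e + mu * (d * (?n - 1))) / ?e"
      by (simp add: add_divide_distrib)
    also have "\<dots> = mu * (d * ?n / ?e)"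
      by (simp add: algebra_simps)
    finally show ?thesis .
  qed
  have *: "(lam + mu) * (u + v) = d + (lam * u + lam * v + A + mu * (u + B))" if "A + d + mu * B = mu * v" for A B u v
    using that by (simp add: algebra_simps)
  have "sojourn_cost c d x i k = ?u + ?v"
    using False by (simp add: sojourn_cost_def)
  then show ?thesis
    unfolding flow_def S N using False *[OF E, of ?u] by simp
qed

lemma wait_weight_pos: "wait_weight x i k > 0"
  using z1 by (simp add: wait_weight_def)

text \<open>An arrival multiplies the weight by at most z and a service divides it by z, or ends the
  sojourn. At the switch to \<open>i\<close> the exponent of the other queue reaches 0, which agrees
  with the factor 1 of the other branch.\<close>

lemma wait_weight_flow:
  assumes t: "tagged x i k"
  shows "flow wait_weight x i k \<le> (lam * z + mu / z) * wait_weight x i k"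
proof (cases "fst x = i")
  case True
  have b: "busy x"
    using t by (simp add: tagged_def)
  have "(\<Sum>r\<in>UNIV. queue_rate r * wait_weight (arrive r x) i k) = lam * wait_weight x i k"
    using True queue_rate_split[of i "wait_weight x i k"] by (simp add: sum_queue_other[of _ i] arrive_busy[OF b] wait_weight_def)
  also have "\<dots> \<le> lam * z * wait_weight x i k"
    using lam_pos z1 wait_weight_pos[of x i k] by simp
  finally have "(\<Sum>r\<in>UNIV. queue_rate r * wait_weight (arrive r x) i k) \<le> lam * z * wait_weight x i k" .
  moreover have "(case k of 0 \<Rightarrow> 0 | Suc k' \<Rightarrow> wait_weight (serve x) i k') \<le> wait_weight x i k / z"
    using True t z1 by (auto simp: wait_weight_def serve_busy[OF b] tagged_def split: nat.split)
  ultimately show ?thesis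
    using True mu_pos mult_left_mono[of "(case k of 0 \<Rightarrow> 0 | Suc k' \<Rightarrow> wait_weight (serve x) i k')" "wait_weight x i k / z" mu]
    by (simp add: flow_def distrib_right)
next
  case False
  have b: "busy x" and i: "i = other (fst x)"
    using t False by (auto simp: tagged_def queue_neq)
  obtain n where n: "snd x (fst x) = Suc n"
    using b by (auto simp: busy_def gr0_conv_Suc)
  have "(\<Sum>r\<in>UNIV. queue_rate r * wait_weight (arrive r x) i k) = queue_rate (fst x) * z * wait_weight x i k + queue_rate (other (fst x)) * wait_weight x i k"
    using False by (simp add: sum_queue_other[of _ "fst x"] arrive_busy[OF b] wait_weight_def)
  also have "\<dots> \<le> queue_rate (fst x) * z * wait_weight x i k + queue_rate (other (fst x)) * z * wait_weight x i k"
    using mult_left_mono[of 1 z "queue_rate (other (fst x))"] z1 wait_weight_pos[of x i k] by (intro add_mono mult_right_mono) auto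
  also have "\<dots> = lam * z * wait_weight x i k"
    using queue_rate_split[of "fst x" "z * wait_weight x i k"] by (simp only: mult.assoc)
  finally have "(\<Sum>r\<in>UNIV. queue_rate r * wait_weight (arrive r x) i k) \<le> lam * z * wait_weight x i k" .
  moreover have "wait_weight (serve x) i k = wait_weight x i k / z"
    using False n i z1 t by (auto simp: wait_weight_def serve_busy[OF b] tagged_def)
  ultimately show ?thesis
    using False by (simp add: flow_def distrib_right)
qed

text \<open>Bernoulli's inequality gives n \<le> z ^ n / (z - 1), so the geometric weight dominates
  the linear cost. Bounding \<open>queue_rate\<close> by lam makes the constant the same for both
  queues.\<close>

lemma sojourn_cost_le_wait_weight:
  assumes "0 \<le> c" "0 \<le> d"
  shows "sojourn_cost c d x i k \<le> (c / mu + d / (mu - lam)) / (z - 1) * wait_weight x i k"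
proof -
  have nat_le: "real n \<le> z ^ n / (z - 1)" for n
    using Bernoulli_inequality[of "z - 1" n] z1 by (simp add: field_simps)
  have "c * (real k + 1) / mu \<le> c / mu * (z ^ Suc k / (z - 1))"
    using mult_left_mono[OF nat_le[of "Suc k"], of "c / mu"] assms mu_pos by (simp add: add.commute)
  also have "\<dots> \<le> c / mu * (wait_weight x i k / (z - 1))"
    using assms mu_pos z1 by (intro mult_left_mono divide_right_mono) (auto simp: wait_weight_def)
  finally have 1: "c * (real k + 1) / mu \<le> c / mu * (wait_weight x i k / (z - 1))" .
  have 2: "(if fst x = i then 0 else d * real (snd x (fst x)) / (mu - queue_rate (fst x))) \<le> d / (mu - lam) * (wait_weight x i k / (z - 1))"
  proof (cases "fst x = i")
    case True
    then show ?thesis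
      using assms lam_mu z1 wait_weight_pos[of x i k] by simp
  next
    case False
    have "d / (mu - queue_rate (fst x)) * real (snd x (fst x)) \<le> d / (mu - lam) * (z ^ snd x (fst x) / (z - 1))"
      using assms lam_mu queue_rate_le[of "fst x"] nat_le by (intro mult_mono divide_left_mono) auto
    also have "\<dots> \<le> d / (mu - lam) * (wait_weight x i k / (z - 1))"
      using assms lam_mu z1 False one_le_power[of z "Suc k"]
      by (intro mult_left_mono divide_right_mono) (auto simp: wait_weight_def simp del: power_Suc)
    finally show ?thesis
      using False by simp
  qed
  have "(c / mu + d / (mu - lam)) / (z - 1) * wait_weight x i k = c / mu * (wait_weight x i k / (z - 1)) + d / (mu - lam) * (wait_weight x i k / (z - 1))"
    by (simp add: add_divide_distrib distrib_right)
  then show ?thesis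
    unfolding sojourn_cost_def using add_mono[OF 1 2] by simp
qed

text \<open>The error satisfies the first-step equation without its cost term. As
  \<open>flow\<close> is monotone, a bound by a multiple of \<open>wait_weight\<close> is passed on
  with one more factor \<open>contraction\<close>.\<close>

lemma mean_cost_error:
  assumes cd: "0 \<le> c" "0 \<le> d" and "tagged x i k"
  shows "0 \<le> sojourn_cost c d x i k - mean_cost c d m x i k \<and>
    sojourn_cost c d x i k - mean_cost c d m x i k \<le> (c / mu + d / (mu - lam)) / (z - 1) * contraction ^ m * wait_weight x i k"
  using assms(3)
proof (induction m arbitrary: x k)
  case 0
  have "0 \<le> sojourn_cost c d x i k"
    using cd mu_pos queue_rate_less[of "fst x"] by (simp add: sojourn_cost_def)
  then show ?case
    using sojourn_cost_le_wait_weight[OF cd, of x i k] by simp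
next
  case (Suc m)
  let ?C = "(c / mu + d / (mu - lam)) / (z - 1) * contraction ^ m"
  let ?e = "\<lambda>x i k. sojourn_cost c d x i k - mean_cost c d m x i k"
  have C: "0 \<le> ?C"
    using cd mu_pos lam_mu z1 contraction_pos by simp
  have e: "(lam + mu) * (sojourn_cost c d x i k - mean_cost c d (Suc m) x i k) = flow ?e x i k"
    unfolding flow_diff right_diff_distrib mean_cost_flow sojourn_cost_flow[OF Suc.prems] by simp
  \<comment> \<open>The zero function is written as a multiple so that \<open>flow_cmult\<close>
    evaluates its flow.\<close>
  have "flow (\<lambda>x i k. 0 * wait_weight x i k) x i k \<le> flow ?e x i k"
    using Suc.IH by (intro flow_mono[OF Suc.prems]) auto
  then have 0: "0 \<le> flow ?e x i k"
    unfolding flow_cmult by simp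
  have "flow ?e x i k \<le> flow (\<lambda>x i k. ?C * wait_weight x i k) x i k"
    using Suc.IH by (intro flow_mono[OF Suc.prems]) auto
  also have "\<dots> \<le> ?C * ((lam * z + mu / z) * wait_weight x i k)"
    unfolding flow_cmult using C by (intro mult_left_mono wait_weight_flow Suc.prems)
  also have "lam * z + mu / z = (lam + mu) * contraction"
    using lam_pos mu_pos by (simp add: contraction_def)
  finally have "(lam + mu) * (sojourn_cost c d x i k - mean_cost c d (Suc m) x i k) \<le> (lam + mu) * (?C * contraction * wait_weight x i k)"
    unfolding e by (simp only: mult_ac)
  moreover have "0 < lam + mu"
    using lam_pos mu_pos by simp
  ultimately have "sojourn_cost c d x i k - mean_cost c d (Suc m) x i k \<le> ?C * contraction * wait_weight x i k"
    by (rule mult_left_le_imp_le)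
  moreover have "0 \<le> sojourn_cost c d x i k - mean_cost c d (Suc m) x i k"
    using 0 \<open>0 < lam + mu\<close> unfolding e[symmetric] by (simp add: zero_le_mult_iff)
  ultimately show ?case
    by (simp add: mult_ac)
qed

lemma mean_cost_tendsto:
  assumes "0 \<le> c" "0 \<le> d" "tagged x i k"
  shows "(\<lambda>m. mean_cost c d m x i k) \<longlonglongrightarrow> sojourn_cost c d x i k"
proof -
  let ?b = "\<lambda>m. (c / mu + d / (mu - lam)) / (z - 1) * contraction ^ m * wait_weight x i k"
  have "?b \<longlonglongrightarrow> (c / mu + d / (mu - lam)) / (z - 1) * 0 * wait_weight x i k"
    using contraction_pos contraction_less_1 by (intro tendsto_intros LIMSEQ_power_zero) auto
  then have "?b \<longlonglongrightarrow> 0"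
    by simp
  then have "(\<lambda>m. sojourn_cost c d x i k - mean_cost c d m x i k) \<longlonglongrightarrow> 0"
    by (rule tendsto_sandwich[rotated 3, OF _ _ _ tendsto_const])
       (intro always_eventually allI mean_cost_error[OF assms, THEN conjunct1] mean_cost_error[OF assms, THEN conjunct2])+
  then have "(\<lambda>m. sojourn_cost c d x i k - (sojourn_cost c d x i k - mean_cost c d m x i k)) \<longlonglongrightarrow> sojourn_cost c d x i k - 0"
    by (intro tendsto_diff tendsto_const)
  then show ?thesis
    by simp
qed

lemma nn_integral_sup_cost:
  assumes cd: "0 \<le> c" "0 \<le> d" and t: "tagged x i k"
  shows "(\<integral>\<^sup>+as. \<integral>\<^sup>+bs. (SUP m. cost_upto c d m x i k as bs) \<partial>services mu \<partial>arrivals lam p) = ennreal (sojourn_cost c d x i k)"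
proof -
  note [measurable] = cost_upto_measurable
  have le: "m \<le> n \<Longrightarrow> cost_upto c d m x i k as bs \<le> cost_upto c d n x i k as bs" for m n as bs
    using incseqD[OF incseq_cost_upto] .
  have inc: "incseq (\<lambda>m bs. cost_upto c d m x i k as bs)" for as
    by (auto simp: incseq_def le_fun_def intro: le)
  have sec [measurable]: "cost_upto c d m x i k as \<in> borel_measurable (services mu)" for m as
    using measurable_section[OF cost_upto_measurable] by simp
  have inc': "incseq (\<lambda>m as. \<integral>\<^sup>+bs. cost_upto c d m x i k as bs \<partial>services mu)"
    by (auto simp: incseq_def le_fun_def intro!: nn_integral_mono le)
  have "(\<integral>\<^sup>+as. \<integral>\<^sup>+bs. (SUP m. cost_upto c d m x i k as bs) \<partial>services mu \<partial>arrivals lam p) =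
      (\<integral>\<^sup>+as. (SUP m. \<integral>\<^sup>+bs. cost_upto c d m x i k as bs \<partial>services mu) \<partial>arrivals lam p)"
    by (intro nn_integral_cong nn_integral_monotone_convergence_SUP inc sec)
  also have "\<dots> = (SUP m. \<integral>\<^sup>+as. \<integral>\<^sup>+bs. cost_upto c d m x i k as bs \<partial>services mu \<partial>arrivals lam p)"
    by (intro nn_integral_monotone_convergence_SUP inc') measurable
  also have "\<dots> = (SUP m. ennreal (mean_cost c d m x i k))"
    by (simp add: nn_integral_cost_upto cd)
  also have "\<dots> = ennreal (sojourn_cost c d x i k)"
  proof (rule LIMSEQ_unique[OF LIMSEQ_SUP])
    have "incseq (\<lambda>m. \<integral>\<^sup>+as. \<integral>\<^sup>+bs. cost_upto c d m x i k as bs \<partial>services mu \<partial>arrivals lam p)"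
      by (auto simp: incseq_def intro!: nn_integral_mono le)
    then show "incseq (\<lambda>m. ennreal (mean_cost c d m x i k))"
      by (simp add: nn_integral_cost_upto cd)
    show "(\<lambda>m. ennreal (mean_cost c d m x i k)) \<longlonglongrightarrow> ennreal (sojourn_cost c d x i k)"
      by (intro tendsto_ennrealI mean_cost_tendsto cd t)
  qed
  finally show ?thesis .
qed

section \<open>Cost as a function of the state found on arrival\<close>

lemma legit_tagged: "legit x \<Longrightarrow> tagged (arrive i x) i (snd x i)"
  by (auto simp: legit_def tagged_def busy_arrive arrive_busy) (auto simp: vacant_def single_def)

definition arrival_cost :: "real \<Rightarrow> real \<Rightarrow> queue \<Rightarrow> state \<Rightarrow> real" where
  "arrival_cost c d i x = c * (real (snd x i) + 1) / mu +
     (if busy x \<and> fst x \<noteq> i then d * real (snd x (fst x)) / (mu - queue_rate (fst x)) else 0)"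

text \<open>Joining the queue without the server leaves the served queue unchanged; in an empty
  system service starts at once, whatever position was recorded.\<close>

lemma sojourn_cost_arrive: "legit x \<Longrightarrow> sojourn_cost c d (arrive i x) i (snd x i) = arrival_cost c d i x"
  by (auto simp: legit_def sojourn_cost_def arrival_cost_def arrive_busy) (auto simp: single_def)

lemma expected_cost_arrival_cost:
  assumes cd: "0 \<le> c" "0 \<le> d"
  shows "expected_cost lam mu c d i p = (\<integral>\<^sup>+x. ennreal (arrival_cost c d i x) \<partial>measure_pmf (steady_state lam mu p))"
proof -
  let ?\<pi> = "steady_state lam mu p"
  note [measurable] = cost_upto_measurable
  have meas [measurable]: "(\<lambda>(as, bs). total_cost c d i x as bs) \<in> borel_measurable (arrivals lam p \<Otimes>\<^sub>M services mu)" for x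
    unfolding total_cost_def by measurable
  let ?N = "arrivals lam p \<Otimes>\<^sub>M services mu"
  have sf: "sigma_finite_measure ?N" ..
  have "(\<lambda>(x, as, bs). total_cost c d i x as bs) \<in> borel_measurable (count_space UNIV \<Otimes>\<^sub>M ?N)"
    \<comment> \<open>There are countably many states, so measurability in the streams for each
      fixed state gives joint measurability.\<close>
    using meas by (intro measurable_pair_measure_countable1) auto
  moreover have "sets (measure_pmf ?\<pi> \<Otimes>\<^sub>M ?N) = sets (count_space UNIV \<Otimes>\<^sub>M ?N)"
    by (intro sets_pair_measure_cong) auto
  ultimately have "(\<lambda>(x, as, bs). total_cost c d i x as bs) \<in> borel_measurable (measure_pmf ?\<pi> \<Otimes>\<^sub>M ?N)"
    using measurable_cong_sets by blast
  then have "expected_cost lam mu c d i p =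
      (\<integral>\<^sup>+x. \<integral>\<^sup>+y. (case y of (as, bs) \<Rightarrow> total_cost c d i x as bs) \<partial>?N \<partial>measure_pmf ?\<pi>)"
    unfolding expected_cost_def by (subst sigma_finite_measure.nn_integral_fst[OF sf, symmetric]) auto
  also have "\<dots> = (\<integral>\<^sup>+x. \<integral>\<^sup>+as. \<integral>\<^sup>+bs. total_cost c d i x as bs \<partial>services mu \<partial>arrivals lam p \<partial>measure_pmf ?\<pi>)"
    using meas by (subst SB.nn_integral_fst[symmetric]) auto
  also have "\<dots> = (\<integral>\<^sup>+x. ennreal (arrival_cost c d i x) \<partial>measure_pmf ?\<pi>)"
  proof (intro nn_integral_cong_AE eventually_mono[OF stationary_legit[OF stationary_steady_state]])
    fix x assume "legit x"
    then show "(\<integral>\<^sup>+as. \<integral>\<^sup>+bs. total_cost c d i x as bs \<partial>services mu \<partial>arrivals lam p) = ennreal (arrival_cost c d i x)"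
      unfolding total_cost_def using nn_integral_sup_cost[OF cd legit_tagged] sojourn_cost_arrive by simp
  qed
  finally show ?thesis .
qed

end

section \<open>Stationary moments and equilibria\<close>

text \<open>Here x and y are the loads of the two queues, a1 and b1 the mean length of the first one
  with the server there and at the other queue, and a2 and b2 likewise for the second. Elimination
  leaves two equations for S and T with determinant ((1 - x) * (1 - y))^2 - (x * y)^2, which factors
  as N.\<close>

lemma mean_value_solution:
  fixes x y :: real
  assumes xy: "0 \<le> x" "0 \<le> y" "x + y < 1"
    and 1: "x * (1 + a1 + b1) = a1" "y * (1 + a2 + b2) = a2"
    and 2: "y * a1 = (1 - x) * b2" "x * a2 = (1 - y) * b1"
  defines "N \<equiv> (1 - (x + y)) * (1 - (x + y) + 2 * x * y)"
  shows "1 + a1 + b1 = (1 - x) * ((1 - y)\<^sup>2 + x * y) / N"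
    and "a2 / (1 - y) = y * ((1 - x)\<^sup>2 + x * y) / N"
proof -
  define S T where "S = 1 + a1 + b1" and "T = 1 + a2 + b2"
  have N: "N > 0"
    unfolding N_def using xy by (intro mult_pos_pos add_pos_nonneg) auto
  have pos: "1 - x > 0" "1 - y > 0"
    using xy by auto
  have a: "a1 = x * S" "a2 = y * T"
    using 1 by (simp_all add: S_def T_def)
  have b: "b1 = (1 - x) * S - 1" "b2 = (1 - y) * T - 1"
    using a by (simp_all add: S_def T_def algebra_simps)
  have e: "y * (x * S) = (1 - x) * ((1 - y) * T - 1)" "x * (y * T) = (1 - y) * ((1 - x) * S - 1)"
    using 2 unfolding a b by auto
  have "S * N = (1 - x) * ((1 - y)\<^sup>2 + x * y)"
    using e unfolding N_def by algebra
  then show "1 + a1 + b1 = (1 - x) * ((1 - y)\<^sup>2 + x * y) / N"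
    using N by (simp add: S_def[symmetric] eq_divide_eq)
  have "T * N = (1 - y) * ((1 - x)\<^sup>2 + x * y)"
    using e unfolding N_def by algebra
  then have "T = (1 - y) * ((1 - x)\<^sup>2 + x * y) / N"
    using N by (simp add: eq_divide_eq)
  then show "a2 / (1 - y) = y * ((1 - x)\<^sup>2 + x * y) / N"
    using pos by (simp add: a)
qed

context polling
begin

declare of_nat_sum [simp del]

section \<open>Integrability and vanishing mean drift\<close>

abbreviation pi_dist :: "state measure" where
  "pi_dist \<equiv> measure_pmf (steady_state lam mu p)"

text \<open>Bernoulli's inequality is applied with base at most sqrt z and the result is squared.
  Capping e at 1 ensures e * (1 + n) \<le> 1 + n * e.\<close>

lemma square_le_power: obtains K where "0 \<le> K" "\<And>n. (1 + real n)\<^sup>2 \<le> K * z ^ n"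
proof -
  define e where "e = min (sqrt z - 1) 1"
  have e: "0 < e" "e \<le> 1" "1 + e \<le> sqrt z"
    using z1 by (auto simp: e_def)
  have "(1 + real n)\<^sup>2 \<le> 1 / e\<^sup>2 * z ^ n" for n
  proof -
    have "e * (1 + real n) \<le> 1 + real n * e"
      using e by (simp add: algebra_simps)
    also have "\<dots> \<le> (1 + e) ^ n"
      using e by (intro Bernoulli_inequality) auto
    also have "\<dots> \<le> sqrt z ^ n"
      using e by (intro power_mono) auto
    finally have "(e * (1 + real n))\<^sup>2 \<le> (sqrt z ^ n)\<^sup>2"
      using e by (intro power_mono) auto
    also have "\<dots> = z ^ n"
      using z1 by (simp add: power_mult[symmetric] mult.commute[of n]) (simp add: power_mult)
    finally have "e\<^sup>2 * (1 + real n)\<^sup>2 \<le> z ^ n"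
      by (simp only: power_mult_distrib)
    then show ?thesis
      using e by (simp add: pos_le_divide_eq mult.commute)
  qed
  then show ?thesis
    using e that[of "1 / e\<^sup>2"] by simp
qed

lemma integrable_quadratic:
  assumes "\<And>x. \<bar>f x\<bar> \<le> C * (1 + real (customers x))\<^sup>2"
  shows "integrable pi_dist f"
proof -
  obtain K where K: "0 \<le> K" "\<And>n. (1 + real n)\<^sup>2 \<le> K * z ^ n"
    using square_le_power by blast
  have "norm (f x) \<le> \<bar>C\<bar> * K * z ^ customers x" for x
  proof -
    have "norm (f x) \<le> C * (1 + real (customers x))\<^sup>2"
      using assms[of x] by simp
    also have "\<dots> \<le> \<bar>C\<bar> * (1 + real (customers x))\<^sup>2"
      by (intro mult_right_mono) auto
    also have "\<dots> \<le> \<bar>C\<bar> * (K * z ^ customers x)"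
      by (intro mult_left_mono K) auto
    finally show ?thesis
      by (simp add: mult.assoc)
  qed
  then have "(\<integral>\<^sup>+x. ennreal (norm (f x)) \<partial>pi_dist) \<le> (\<integral>\<^sup>+x. ennreal (\<bar>C\<bar> * K) * ennreal (z ^ customers x) \<partial>pi_dist)"
    using K z1 by (intro nn_integral_mono) (simp add: ennreal_mult[symmetric])
  also have "\<dots> < \<infinity>"
    using steady_state_tail by (simp add: nn_integral_cmult ennreal_mult_less_top)
  finally show ?thesis
    by (intro integrableI_bounded) auto
qed

text \<open>\<open>stationary_integral\<close> equates inflow and outflow of \<open>f\<close> in
  \<open>ennreal\<close>. Quadratic growth makes both integrable, so they may be subtracted;
  \<open>g\<close> is their difference on the legit states, which carry all the mass.\<close>

lemma expectation_drift:
  assumes f: "\<And>x. 0 \<le> f x" "\<And>x. f x \<le> (1 + real (customers x))\<^sup>2"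
    and g: "\<And>x. legit x \<Longrightarrow> (\<Sum>i\<in>UNIV. queue_rate i * f (arrive i x)) + (if busy x then mu * f (serve x) else 0) =
      (lam + (if busy x then mu else 0)) * f x + g x"
  shows "(\<integral>x. g x \<partial>pi_dist) = 0"
proof -
  define F where "F x = (\<Sum>i\<in>UNIV. queue_rate i * f (arrive i x)) + (if busy x then mu * f (serve x) else 0)" for x
  define H where "H x = (lam + (if busy x then mu else 0)) * f x" for x
  have F0: "0 \<le> F x" for x
    unfolding F_def using mu_pos by (intro add_nonneg_nonneg sum_nonneg) (simp_all add: f(1))
  have H0: "0 \<le> H x" for x
    using f(1) lam_pos mu_pos by (simp add: H_def)
  have "F x \<le> (4 * lam + mu) * (1 + real (customers x))\<^sup>2" for x
  proof -
    \<comment> \<open>An arrival at most doubles 1 + customers, whence the factor 4.\<close>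
    have "f (arrive i x) \<le> 4 * (1 + real (customers x))\<^sup>2" for i
    proof -
      have "f (arrive i x) \<le> (1 + real (Suc (customers x)))\<^sup>2"
        using f(2)[of "arrive i x"] by (simp only: customers_arrive)
      also have "\<dots> \<le> (2 * (1 + real (customers x)))\<^sup>2"
        by (intro power_mono) auto
      also have "\<dots> = 4 * (1 + real (customers x))\<^sup>2"
        by (subst power_mult_distrib) simp
      finally show ?thesis .
    qed
    then have "(\<Sum>i\<in>UNIV. queue_rate i * f (arrive i x)) \<le> (\<Sum>i\<in>UNIV. queue_rate i * (4 * (1 + real (customers x))\<^sup>2))"
      by (intro sum_mono mult_left_mono) auto
    also have "\<dots> = 4 * lam * (1 + real (customers x))\<^sup>2"
      using queue_rate_split[of Q1 "4 * (1 + real (customers x))\<^sup>2"] by (simp only: sum_queue_other[of _ Q1]; simp)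
    finally have "(\<Sum>i\<in>UNIV. queue_rate i * f (arrive i x)) \<le> 4 * lam * (1 + real (customers x))\<^sup>2" .
    moreover have "(if busy x then mu * f (serve x) else 0) \<le> mu * (1 + real (customers x))\<^sup>2"
    proof (cases "busy x")
      case True
      have "f (serve x) \<le> (1 + real (customers (serve x)))\<^sup>2"
        by (rule f)
      also have "\<dots> \<le> (1 + real (customers x))\<^sup>2"
        using customers_serve[OF True] by (intro power_mono) linarith+
      finally show ?thesis
        using True mu_pos by simp
    qed (use mu_pos in simp)
    ultimately show ?thesis
      by (simp add: F_def distrib_right)
  qed
  then have intF: "integrable pi_dist F"
    using F0 by (intro integrable_quadratic[of F "4 * lam + mu"]) simp
  have "H x \<le> (lam + mu) * (1 + real (customers x))\<^sup>2" for x
    unfolding H_def using f lam_pos mu_pos by (intro mult_mono) auto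
  then have intH: "integrable pi_dist H"
    using H0 by (intro integrable_quadratic[of H "lam + mu"]) simp
  have "ennreal (F x) = jumps (\<lambda>x. ennreal (f x)) x" for x
    using f(1) mu_pos by (auto simp: F_def jumps_def sum_queue ennreal_mult)
  moreover have "ennreal (H x) = exit_rate x * ennreal (f x)" for x
    using f(1) lam_pos mu_pos by (auto simp: H_def exit_rate_def ennreal_mult)
  ultimately have "(\<integral>\<^sup>+x. ennreal (F x) \<partial>pi_dist) = (\<integral>\<^sup>+x. ennreal (H x) \<partial>pi_dist)"
    using stationary_integral[OF stationary_steady_state] by simp
  then have "(\<integral>x. F x \<partial>pi_dist) = (\<integral>x. H x \<partial>pi_dist)"
    using F0 H0 by (simp add: integral_eq_nn_integral)
  moreover have "(\<integral>x. g x \<partial>pi_dist) = (\<integral>x. F x - H x \<partial>pi_dist)"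
  proof (intro integral_cong_AE eventually_mono[OF stationary_legit[OF stationary_steady_state]])
    fix x assume "legit x"
    then show "g x = F x - H x"
      using g[of x] by (simp add: F_def H_def)
  qed auto
  ultimately show ?thesis
    using intF intH by simp
qed

section \<open>Moment equations\<close>

definition serving :: "queue \<Rightarrow> state \<Rightarrow> real" where
  "serving s x = (if busy x \<and> fst x = s then 1 else 0)"

definition mom :: "queue \<Rightarrow> queue \<Rightarrow> real" where
  "mom s j = (\<integral>x. serving s x * real (snd x j) \<partial>pi_dist)"

lemma count_le_customers: "n j \<le> (\<Sum>i\<in>UNIV. n i)" for n :: "queue \<Rightarrow> nat"
  by (cases j) (auto simp: sum_queue)

lemma count_prod_le_square: "real (n i) * real (n j) \<le> (1 + real (\<Sum>i\<in>UNIV. n i))\<^sup>2" for n :: "queue \<Rightarrow> nat"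
  using count_le_customers[of n i] count_le_customers[of n j] unfolding power2_eq_square by (intro mult_mono) auto

lemma count_le_square: "real (n j) \<le> (1 + real (\<Sum>i\<in>UNIV. n i))\<^sup>2" for n :: "queue \<Rightarrow> nat"
proof -
  have "real (n j) * 1 \<le> (1 + real (\<Sum>i\<in>UNIV. n i)) * (1 + real (\<Sum>i\<in>UNIV. n i))"
    using count_le_customers[of n j] by (intro mult_mono) auto
  then show ?thesis
    by (simp only: power2_eq_square mult_1_right)
qed

lemma integrable_serving_count [simp]: "integrable pi_dist (\<lambda>x. serving s x * real (snd x j))"
  using count_le_square[of "snd _" j] by (intro integrable_quadratic[of _ 1]) (auto simp: serving_def)

lemma integrable_count [simp]: "integrable pi_dist (\<lambda>x. real (snd x j))"
  using count_le_square[of "snd _" j] by (intro integrable_quadratic[of _ 1]) auto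

lemma integrable_serving [simp]: "integrable pi_dist (serving s)"
  by (intro integrable_quadratic[of _ 1]) (auto simp: serving_def)

lemma serving_vacant [simp]: "serving s (vacant i) = 0"
  by (simp add: serving_def)

lemma legit_cases:
  assumes "legit x"
  obtains "busy x" | i where "x = vacant i"
  using assms by (auto simp: legit_def)

lemma mean_count: "(\<integral>x. real (snd x i) \<partial>pi_dist) = mom i i + mom (other i) i"
proof -
  have "(\<integral>x. real (snd x i) \<partial>pi_dist) = (\<integral>x. serving i x * real (snd x i) + serving (other i) x * real (snd x i) \<partial>pi_dist)"
  proof (intro integral_cong_AE eventually_mono[OF stationary_legit[OF stationary_steady_state]])
    fix x assume "legit x"
    then show "real (snd x i) = serving i x * real (snd x i) + serving (other i) x * real (snd x i)"
      by (cases rule: legit_cases) (auto simp: serving_def vacant_def queue_neq)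
  qed auto
  then show ?thesis
    by (simp add: mom_def)
qed

text \<open>Mean drift of the length of queue \<open>i\<close>: arrivals balance services, which
  occur at rate mu while the server works there.\<close>

lemma mean_serving: "mu * (\<integral>x. serving i x \<partial>pi_dist) = queue_rate i"
proof -
  have "(\<integral>x. queue_rate i - mu * serving i x \<partial>pi_dist) = 0"
  proof (rule expectation_drift)
    fix x assume "legit x"
    then show "(\<Sum>j\<in>UNIV. queue_rate j * real (snd (arrive j x) i)) + (if busy x then mu * real (snd (serve x) i) else 0) =
        (lam + (if busy x then mu else 0)) * real (snd x i) + (queue_rate i - mu * serving i x)"
    proof (cases rule: legit_cases)
      case 1
      then have n: "snd x (fst x) \<ge> 1"
        by (simp add: busy_def)
      show ?thesis
        using 1 n queue_rate_split[of i "real (snd x i)"]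
        by (cases "fst x = i") (auto simp: sum_queue_other[of _ i] arrive_busy serve_busy serving_def of_nat_diff algebra_simps)
    next
      case (2 s)
      then show ?thesis
        by (simp add: sum_queue_other[of _ i]) (simp add: vacant_def single_def)
    qed
  qed (auto simp: count_le_square)
  then show ?thesis
    by (simp add: measure_pmf.prob_space[simplified])
qed

text \<open>For a squared length n, an arrival adds 2 * n + 1 and a service removes 2 * n - 1. The
  constants combine by \<open>mean_serving\<close>, and the result is halved.\<close>

lemma second_moment: "queue_rate i * (1 + mom i i + mom (other i) i) = mu * mom i i"
proof -
  have "(\<integral>x. queue_rate i * (2 * real (snd x i) + 1) + mu * (serving i x - 2 * (serving i x * real (snd x i))) \<partial>pi_dist) = 0"
  proof (rule expectation_drift)
    fix x assume "legit x"
    then show "(\<Sum>j\<in>UNIV. queue_rate j * (real (snd (arrive j x) i))\<^sup>2) + (if busy x then mu * (real (snd (serve x) i))\<^sup>2 else 0) =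
        (lam + (if busy x then mu else 0)) * (real (snd x i))\<^sup>2 +
        (queue_rate i * (2 * real (snd x i) + 1) + mu * (serving i x - 2 * (serving i x * real (snd x i))))"
    proof (cases rule: legit_cases)
      case 1
      then have n: "snd x (fst x) \<ge> 1"
        by (simp add: busy_def)
      show ?thesis
        using 1 n queue_rate_split[of i "(real (snd x i))\<^sup>2"]
        by (cases "fst x = i") (auto simp: sum_queue_other[of _ i] arrive_busy serve_busy serving_def of_nat_diff algebra_simps power2_eq_square)
    next
      case (2 s)
      then show ?thesis
        by (simp add: sum_queue_other[of _ i]) (simp add: vacant_def single_def)
    qed
  qed (auto simp: count_prod_le_square power2_eq_square[of "real (_ i)"])
  then have "queue_rate i * (2 * (mom i i + mom (other i) i) + 1) + (queue_rate i - 2 * (mu * mom i i)) = 0"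
    using mean_serving[of i]
    by (simp add: measure_pmf.prob_space[simplified] mean_count right_diff_distrib flip: mom_def)
  then show ?thesis
    by (simp add: algebra_simps)
qed

text \<open>The function \<open>n\<^sub>1 n\<^sub>2\<close> restricted to the server being at queue \<open>s\<close> vanishes as soon as a queue is empty,
  so the switches of the server do not contribute to its drift.\<close>

lemma cross_moment: "queue_rate (other s) * mom s s = (mu - queue_rate s) * mom s (other s)"
proof -
  let ?o = "other s"
  have "(\<integral>x. queue_rate s * (serving s x * real (snd x ?o)) + queue_rate ?o * (serving s x * real (snd x s)) - mu * (serving s x * real (snd x ?o)) \<partial>pi_dist) = 0"
  proof (rule expectation_drift)
    let ?f = "\<lambda>x. if fst x = s then real (snd x s) * real (snd x ?o) else 0"
    show "?f x \<le> (1 + real (customers x))\<^sup>2" for x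
      by (auto simp: count_prod_le_square)
    fix x assume "legit x"
    then show "(\<Sum>j\<in>UNIV. queue_rate j * ?f (arrive j x)) + (if busy x then mu * ?f (serve x) else 0) =
        (lam + (if busy x then mu else 0)) * ?f x +
        (queue_rate s * (serving s x * real (snd x ?o)) + queue_rate ?o * (serving s x * real (snd x s)) - mu * (serving s x * real (snd x ?o)))"
    proof (cases rule: legit_cases)
      case 1
      then have n: "snd x (fst x) \<ge> 1"
        by (simp add: busy_def)
      show ?thesis
      proof (cases "fst x = s")
        case True
        have serve: "?f (serve x) = (real (snd x s) - 1) * real (snd x ?o)"
          using 1 n True by (auto simp: serve_busy of_nat_diff)
        have arrive: "(\<Sum>j\<in>UNIV. queue_rate j * ?f (arrive j x)) =
            queue_rate s * ((real (snd x s) + 1) * real (snd x ?o)) + queue_rate ?o * (real (snd x s) * (real (snd x ?o) + 1))"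
          using 1 True by (simp add: sum_queue_other[of _ s] arrive_busy algebra_simps)
        show ?thesis
          unfolding arrive serve using 1 True queue_rate_split[of s "real (snd x s) * real (snd x ?o)"]
          by (simp add: serving_def algebra_simps)
      next
        case False
        then have "?f (serve x) = 0"
          using 1 n by (auto simp: serve_busy queue_neq)
        then show ?thesis
          using 1 False by (simp add: sum_queue_other[of _ s] arrive_busy serving_def)
      qed
    next
      case (2 i)
      then show ?thesis
        by (simp add: sum_queue_other[of _ s]) (simp add: vacant_def single_def)
    qed
  qed auto
  then have "queue_rate s * mom s ?o + queue_rate ?o * mom s s - mu * mom s ?o = 0"
    by (simp flip: mom_def)
  then show ?thesis
    by (simp add: algebra_simps)
qed

text \<open>The two quotients of \<open>mean_value_solution\<close>, weighted by c / mu for the time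
  in the served queue and by d / mu for the wait.\<close>

definition mean :: "real \<Rightarrow> real \<Rightarrow> queue \<Rightarrow> real" where
  "mean c d i = (let x = queue_rate i / mu; y = queue_rate (other i) / mu in
     (c * ((1 - x) * ((1 - y)\<^sup>2 + x * y)) + d * (y * ((1 - x)\<^sup>2 + x * y))) /
     (mu * ((1 - (x + y)) * (1 - (x + y) + 2 * x * y))))"

lemma expected_cost_eq:
  assumes cd: "0 \<le> c" "0 \<le> d"
  shows "expected_cost lam mu c d i p = ennreal (mean c d i)" and "0 \<le> mean c d i"
proof -
  let ?o = "other i"
  define x y where "x = queue_rate i / mu" and "y = queue_rate ?o / mu"
  define N where "N = (1 - (x + y)) * (1 - (x + y) + 2 * x * y)"
  have xy: "0 \<le> x" "0 \<le> y" "x + y < 1"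
    using mu_pos lam_mu sum_queue_rate[of i] by (auto simp: x_def y_def add_divide_distrib[symmetric])
  have arrival_cost: "arrival_cost c d i z = c / mu * real (snd z i) + c / mu + d / (mu - queue_rate ?o) * (serving ?o z * real (snd z ?o))" for z
    by (auto simp: arrival_cost_def serving_def queue_neq add_divide_distrib distrib_left)
  have phi0: "0 \<le> arrival_cost c d i z" for z
    using cd mu_pos queue_rate_less by (auto simp: arrival_cost_def intro!: add_nonneg_nonneg divide_nonneg_nonneg less_imp_le[OF queue_rate_less])
  have eq: "(\<integral>z. arrival_cost c d i z \<partial>pi_dist) = c / mu * (1 + mom i i + mom ?o i) + d / (mu - queue_rate ?o) * mom ?o ?o"
    unfolding arrival_cost by (simp add: measure_pmf.prob_space[simplified] mean_count distrib_left add_divide_distrib flip: mom_def)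
  have "1 + mom i i + mom ?o i = (1 - x) * ((1 - y)\<^sup>2 + x * y) / N"
    "mom ?o ?o / (1 - y) = y * ((1 - x)\<^sup>2 + x * y) / N"
    unfolding N_def
    by (rule mean_value_solution[where ?a1.0="mom i i" and ?b1.0="mom ?o i" and ?a2.0="mom ?o ?o" and ?b2.0="mom i ?o", OF xy];
        use second_moment[of i] second_moment[of ?o] cross_moment[of i] cross_moment[of ?o] mu_pos in
        \<open>simp add: x_def y_def field_simps\<close>)+
  moreover have "d / (mu - queue_rate ?o) * mom ?o ?o = d / mu * (mom ?o ?o / (1 - y))"
    using mu_pos by (simp add: y_def field_simps)
  ultimately have "(\<integral>z. arrival_cost c d i z \<partial>pi_dist) = c / mu * ((1 - x) * ((1 - y)\<^sup>2 + x * y) / N) + d / mu * (y * ((1 - x)\<^sup>2 + x * y) / N)"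
    unfolding eq by simp
  also have "\<dots> = mean c d i"
    by (simp add: mean_def x_def[symmetric] y_def[symmetric] N_def[symmetric] add_divide_distrib)
  finally have m: "(\<integral>z. arrival_cost c d i z \<partial>pi_dist) = mean c d i" .
  have "integrable pi_dist (arrival_cost c d i)"
    unfolding arrival_cost[abs_def] by (intro Bochner_Integration.integrable_add integrable_mult_right) auto
  then show "expected_cost lam mu c d i p = ennreal (mean c d i)"
    unfolding expected_cost_arrival_cost[OF cd] using phi0 m by (simp add: nn_integral_eq_integral)
  show "0 \<le> mean c d i"
    unfolding m[symmetric] using phi0 by (intro integral_nonneg_AE) auto
qed

section \<open>Comparison of policies\<close>

lemma policy_cost_eq:
  assumes "0 \<le> c" "0 \<le> d" "r \<in> {0..1}"
  shows "policy_cost lam mu c d r p = ennreal (r * mean c d Q1 + (1 - r) * mean c d Q2)"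
  using assms expected_cost_eq[OF assms(1,2)]
  by (simp add: policy_cost_def ennreal_mult[symmetric] ennreal_plus[symmetric] del: ennreal_plus)

text \<open>With p' = p this compares deviations of one customer; with r = p and r' = p' it compares
  policies of the whole population. Nonnegative mean costs make the passage from
  \<open>ennreal\<close> to the reals exact.\<close>

lemma policy_cost_le_iff:
  assumes "0 \<le> c" "0 \<le> d" "r \<in> {0..1}" "polling lam mu p' z" "r' \<in> {0..1}"
  shows "policy_cost lam mu c d r p \<le> policy_cost lam mu c d r' p' \<longleftrightarrow>
    r * mean c d Q1 + (1 - r) * mean c d Q2 \<le> r' * polling.mean lam mu p' c d Q1 + (1 - r') * polling.mean lam mu p' c d Q2"
  unfolding policy_cost_eq[OF assms(1-3)] polling.policy_cost_eq[OF assms(4,1,2,5)]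
  using assms polling.expected_cost_eq(2)[OF assms(4,1,2)] by (intro ennreal_le_iff) simp

text \<open>Over the common denominator N the numerators differ by (x - y) * (c * (1 - (x + y)) -
  d). Here x + y = \<rho> and x - y = \<rho> * (2 * p - 1), so the positive factor is \<rho> /
  N.\<close>

lemma mean_diff:
  defines "\<rho> \<equiv> lam / mu"
  obtains k where "0 < k" "mean c d Q1 - mean c d Q2 = k * ((2 * p - 1) * (c * (1 - \<rho>) - d))"
proof -
  define x y where "x = queue_rate Q1 / mu" and "y = queue_rate Q2 / mu"
  have xy: "x = \<rho> * p" "y = \<rho> * (1 - p)"
    by (simp_all add: x_def y_def queue_rate_Q \<rho>_def)
  have \<rho>: "0 < \<rho>" "\<rho> < 1"
    using lam_pos mu_pos lam_mu by (simp_all add: \<rho>_def)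
  define N where "N = mu * ((1 - \<rho>) * (1 - \<rho> + 2 * x * y))"
  have "0 \<le> x * y"
    using \<rho> p01 by (simp add: xy)
  then have N: "0 < N"
    unfolding N_def using mu_pos \<rho> by (intro mult_pos_pos add_pos_nonneg) auto
  have sum: "x + y = \<rho>" "y + x = \<rho>"
    by (simp_all add: xy algebra_simps)
  have "mean c d Q1 - mean c d Q2 =
      (c * ((1 - x) * ((1 - y)\<^sup>2 + x * y)) + d * (y * ((1 - x)\<^sup>2 + x * y)) -
       (c * ((1 - y) * ((1 - x)\<^sup>2 + y * x)) + d * (x * ((1 - y)\<^sup>2 + y * x)))) / N"
    by (simp add: mean_def x_def[symmetric] y_def[symmetric] sum N_def diff_divide_distrib mult.commute[of y x] mult.assoc)
  also have "c * ((1 - x) * ((1 - y)\<^sup>2 + x * y)) + d * (y * ((1 - x)\<^sup>2 + x * y)) -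
       (c * ((1 - y) * ((1 - x)\<^sup>2 + y * x)) + d * (x * ((1 - y)\<^sup>2 + y * x))) = (x - y) * (c * (1 - (x + y)) - d)"
    by algebra
  also have "x - y = \<rho> * (2 * p - 1)"
    by (simp add: xy algebra_simps)
  finally have "mean c d Q1 - mean c d Q2 = \<rho> / N * ((2 * p - 1) * (c * (1 - \<rho>) - d))"
    by (simp add: sum)
  then show ?thesis
    by (rule that[rotated]) (use N \<rho> in simp)
qed

text \<open>This form isolates p: it enters through t = p * (1 - p) alone, in a fraction t / (a + b
  * t) that is monotone in t.\<close>

lemma mean_total:
  defines "\<rho> \<equiv> lam / mu"
  shows "p * mean c d Q1 + (1 - p) * mean c d Q2 =
    (c + (d - c) * (\<rho> * (2 - 2 * \<rho> + \<rho>\<^sup>2)) * (p * (1 - p) / (1 - \<rho> + 2 * \<rho>\<^sup>2 * (p * (1 - p))))) / (mu * (1 - \<rho>))"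
proof -
  define x y where "x = \<rho> * p" and "y = \<rho> * (1 - p)"
  have queue_rate: "queue_rate Q1 / mu = x" "queue_rate Q2 / mu = y"
    by (simp_all add: x_def y_def queue_rate_Q \<rho>_def)
  have \<rho>: "0 < \<rho>" "\<rho> < 1"
    using lam_pos mu_pos lam_mu by (simp_all add: \<rho>_def)
  define M where "M = 1 - \<rho> + 2 * \<rho>\<^sup>2 * (p * (1 - p))"
  have M: "M = 1 - (x + y) + 2 * x * y"
    by (simp add: M_def x_def y_def algebra_simps power2_eq_square)
  have Mpos: "0 < M"
    unfolding M_def using \<rho> p01 by (intro add_pos_nonneg) auto
  have sum: "x + y = \<rho>" "y + x = \<rho>"
    by (simp_all add: x_def y_def algebra_simps)
  define A B where "A = c * ((1 - x) * ((1 - y)\<^sup>2 + x * y)) + d * (y * ((1 - x)\<^sup>2 + x * y))"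
    and "B = c * ((1 - y) * ((1 - x)\<^sup>2 + y * x)) + d * (x * ((1 - y)\<^sup>2 + y * x))"
  have m: "mean c d Q1 = A / (mu * (1 - \<rho>) * M)" "mean c d Q2 = B / (mu * (1 - \<rho>) * M)"
    by (simp_all add: mean_def queue_rate A_def B_def M sum mult.commute[of y x] mult.assoc)
  have "p * A + (1 - p) * B = c * M + (d - c) * (\<rho> * (2 - 2 * \<rho> + \<rho>\<^sup>2)) * (p * (1 - p))"
    unfolding A_def B_def M_def x_def y_def by algebra
  then have "(p * A + (1 - p) * B) / (mu * (1 - \<rho>) * M) =
      (c * M + (d - c) * (\<rho> * (2 - 2 * \<rho> + \<rho>\<^sup>2)) * (p * (1 - p))) / M / (mu * (1 - \<rho>))"
    by (simp add: mult.commute)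
  also have "(c * M + (d - c) * (\<rho> * (2 - 2 * \<rho> + \<rho>\<^sup>2)) * (p * (1 - p))) / M =
      c + (d - c) * (\<rho> * (2 - 2 * \<rho> + \<rho>\<^sup>2)) * (p * (1 - p) / M)"
    using Mpos by (simp add: add_divide_distrib)
  finally show ?thesis
    unfolding m M_def[symmetric] by (simp add: add_divide_distrib)
qed

text \<open>The cost of a deviation r is affine in r with slope
  \<open>mean c d Q1 - mean c d Q2\<close>, whose sign \<open>mean_diff\<close> provides.\<close>

lemma nash_iff:
  assumes "0 \<le> c" "0 \<le> d"
  shows "nash lam mu c d p \<longleftrightarrow> (\<forall>r\<in>{0..1}. 0 \<le> (r - p) * ((2 * p - 1) * (c * (1 - lam / mu) - d)))"
proof -
  obtain k where k: "0 < k" "mean c d Q1 - mean c d Q2 = k * ((2 * p - 1) * (c * (1 - lam / mu) - d))"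
    by (rule mean_diff)
  have "policy_cost lam mu c d p p \<le> policy_cost lam mu c d r p \<longleftrightarrow> 0 \<le> (r - p) * ((2 * p - 1) * (c * (1 - lam / mu) - d))"
    if "r \<in> {0..1}" for r
  proof -
    have "policy_cost lam mu c d p p \<le> policy_cost lam mu c d r p \<longleftrightarrow> 0 \<le> (r - p) * (mean c d Q1 - mean c d Q2)"
      unfolding policy_cost_le_iff[OF assms p01 polling_axioms that] by (simp add: algebra_simps)
    also have "\<dots> \<longleftrightarrow> 0 \<le> k * ((r - p) * ((2 * p - 1) * (c * (1 - lam / mu) - d)))"
      unfolding k(2) by (simp only: mult.left_commute)
    finally show ?thesis
      using k(1) by (simp only: zero_le_mult_iff) auto
  qed
  then show ?thesis
    unfolding nash_def using p01 by blast
qed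

end

text \<open>For a > 0 and positive denominators this shows that t / (a + b * t) increases with
  t.\<close>

lemma ratio_diff:
  fixes a b s t :: real
  assumes "0 < a + b * s" "0 < a + b * t"
  shows "t / (a + b * t) - s / (a + b * s) = a * (t - s) / ((a + b * t) * (a + b * s))"
  using assms by (simp add: diff_frac_eq) (simp add: algebra_simps)

text \<open>All factors other than d - c and the difference of the values of p * (1 - p) are
  positive, so they do not affect the sign. Mixing the queues is thus favoured for c > d and
  penalised for c < d.\<close>

lemma social_cost_le_iff:
  assumes p: "polling lam mu p z" and r: "polling lam mu r z" and cd: "0 \<le> c" "0 \<le> d"
  shows "policy_cost lam mu c d p p \<le> policy_cost lam mu c d r r \<longleftrightarrow> 0 \<le> (d - c) * (r * (1 - r) - p * (1 - p))"
proof -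
  interpret p: polling lam mu p z by fact
  interpret r: polling lam mu r z by fact
  define \<rho> where "\<rho> = lam / mu"
  have \<rho>: "0 < \<rho>" "\<rho> < 1"
    using p.lam_pos p.mu_pos p.lam_mu by (simp_all add: \<rho>_def)
  define K where "K = \<rho> * (2 - 2 * \<rho> + \<rho>\<^sup>2)"
  have K: "0 < K"
    unfolding K_def using \<rho> by (intro mult_pos_pos add_pos_nonneg) auto
  let ?s = "p * (1 - p)" and ?t = "r * (1 - r)"
  have st: "0 \<le> ?s" "0 \<le> ?t"
    using p.p01 r.p01 by auto
  have pos: "0 < 1 - \<rho> + 2 * \<rho>\<^sup>2 * ?s" "0 < 1 - \<rho> + 2 * \<rho>\<^sup>2 * ?t"
    using \<rho> st by (intro add_pos_nonneg; simp)+
  let ?D = "(1 - \<rho> + 2 * \<rho>\<^sup>2 * ?t) * (1 - \<rho> + 2 * \<rho>\<^sup>2 * ?s)"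
  have D: "0 < ?D"
    by (rule mult_pos_pos[OF pos(2) pos(1)])
  have "policy_cost lam mu c d p p \<le> policy_cost lam mu c d r r \<longleftrightarrow>
      (c + (d - c) * K * (?s / (1 - \<rho> + 2 * \<rho>\<^sup>2 * ?s))) / (mu * (1 - \<rho>)) \<le>
      (c + (d - c) * K * (?t / (1 - \<rho> + 2 * \<rho>\<^sup>2 * ?t))) / (mu * (1 - \<rho>))"
    unfolding p.policy_cost_le_iff[OF cd p.p01 r r.p01] p.mean_total r.mean_total K_def \<rho>_def ..
  also have "\<dots> \<longleftrightarrow> 0 \<le> (d - c) * K * (?t / (1 - \<rho> + 2 * \<rho>\<^sup>2 * ?t) - ?s / (1 - \<rho> + 2 * \<rho>\<^sup>2 * ?s))"
    using p.mu_pos \<rho> by (simp add: divide_le_cancel right_diff_distrib)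
  also have "\<dots> \<longleftrightarrow> 0 \<le> K * (1 - \<rho>) / ?D * ((d - c) * (?t - ?s))"
    unfolding ratio_diff[OF pos] by (simp only: times_divide_eq_left times_divide_eq_right mult_ac)
  also have "\<dots> \<longleftrightarrow> 0 \<le> (d - c) * (?t - ?s)"
  proof -
    have "0 < K * (1 - \<rho>) / ?D"
      using K \<rho> D by simp
    then show ?thesis
      by (simp only: zero_le_mult_iff) auto
  qed
  finally show ?thesis .
qed

theorem theorem3p3:
  fixes lam mu \<rho> c d :: real
  assumes "lam > 0" and "mu > 0" and "\<rho> = lam / mu" and "\<rho> < 1"
    and "c > 0" and "d \<ge> 0"
  shows "(c * (1 - \<rho>) > d \<longrightarrow>
            {p. nash lam mu c d p} = {1/2} \<and> socially_optimal lam mu c d (1/2)) \<and>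
         (c * (1 - \<rho>) = d \<longrightarrow>
            {p. nash lam mu c d p} = {0..1} \<and> {p. socially_optimal lam mu c d p} = {1/2}) \<and>
         (c * (1 - \<rho>) < d \<longrightarrow>
            {p. nash lam mu c d p} = {0, 1/2, 1} \<and>
            (c > d \<longrightarrow> {p \<in> {0, 1/2, 1}. socially_optimal lam mu c d p} = {1/2}) \<and>
            (c = d \<longrightarrow> {p \<in> {0, 1/2, 1}. socially_optimal lam mu c d p} = {0, 1/2, 1}) \<and>
            (c < d \<longrightarrow> {p \<in> {0, 1/2, 1}. socially_optimal lam mu c d p} = {0, 1}))"
proof -
  have "1 < mu / lam"
    using assms by simp
  then obtain z where "1 < z" "z < mu / lam"
    using dense by blast
  then have pol: "polling lam mu p z" if "p \<in> {0..1}" for p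
    using assms that by unfold_locales (auto simp: field_simps)
  have cd: "0 \<le> c" "0 \<le> d"
    using assms by auto
  let ?k = "c * (1 - \<rho>) - d"
  have nash: "nash lam mu c d p \<longleftrightarrow> p \<in> {0..1} \<and> (\<forall>r\<in>{0..1}. 0 \<le> (r - p) * ((2 * p - 1) * ?k))" for p
    using polling.nash_iff[OF pol cd, of p] nash_def \<open>\<rho> = lam / mu\<close> by metis
  have soc: "socially_optimal lam mu c d p \<longleftrightarrow>
      p \<in> {0..1} \<and> (\<forall>r\<in>{0..1}. 0 \<le> (d - c) * (r * (1 - r) - p * (1 - p)))" for p
    unfolding socially_optimal_def using social_cost_le_iff[OF pol pol cd] by blast
  \<comment> \<open>Places cases (i) and (ii) in the regime d < c.\<close>
  have dc: "c * (1 - \<rho>) < c"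
    using assms by simp
  \<comment> \<open>Completing the square: p * (1 - p) is largest at 1/2.\<close>
  have sq: "r * (1 - r) - 1/2 * (1 - 1/2) = - ((r - 1/2)\<^sup>2)" for r :: real
    by (simp add: power2_eq_square algebra_simps)
  have half: "socially_optimal lam mu c d (1/2)" if "d \<le> c"
    unfolding soc sq using that by (auto simp: mult_nonpos_nonneg)
  have only_half: "p = 1/2" if "socially_optimal lam mu c d p" "d < c" for p
  proof -
    have "0 \<le> (d - c) * (1/2 * (1 - 1/2) - p * (1 - p))"
      using that(1) unfolding soc by (elim conjE ballE[of _ _ "1/2"]) auto
    also have "1/2 * (1 - 1/2) - p * (1 - p) = (p - 1/2)\<^sup>2"
      by (simp add: power2_eq_square algebra_simps)
    finally have "(p - 1/2)\<^sup>2 \<le> 0"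
      using \<open>d < c\<close> by (simp add: zero_le_mult_iff)
    then show ?thesis
      by simp
  qed
  have all_nash: "{p. nash lam mu c d p} = {0..1}" if "?k = 0"
    unfolding nash that by auto
  have half_nash: "nash lam mu c d (1/2)"
    unfolding nash by simp
  have nash_pos: "nash lam mu c d p \<longleftrightarrow> p = 1/2" if "?k > 0" for p
  proof
    assume "nash lam mu c d p"
    then have "p \<in> {0..1}" and *: "\<And>r. r \<in> {0..1} \<Longrightarrow> 0 \<le> ((r - p) * (2 * p - 1)) * ?k"
      unfolding nash by (auto simp only: mult.assoc)
    have "0 \<le> (r - p) * (2 * p - 1)" if "r \<in> {0..1}" for r
      using *[OF that] \<open>?k > 0\<close> by (simp only: zero_le_mult_iff) auto
    \<comment> \<open>The extreme deviations decide: for p > 1/2 joining queue 2 (r = 0) is cheaper,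
      for p < 1/2 joining queue 1.\<close>
    from this[of 0] this[of 1] have "0 \<le> (0 - p) * (2 * p - 1)" "0 \<le> (1 - p) * (2 * p - 1)"
      by auto
    moreover have "(0 - p) * (2 * p - 1) < 0" if "1/2 < p"
      using that by (intro mult_neg_pos) auto
    moreover have "(1 - p) * (2 * p - 1) < 0" if "p < 1/2"
      using that by (intro mult_pos_neg) auto
    ultimately show "p = 1/2"
      by linarith
  qed (simp only: half_nash)
  have nash_neg: "nash lam mu c d p \<longleftrightarrow> p \<in> {0, 1/2, 1}" if "?k < 0" for p
  proof
    assume "nash lam mu c d p"
    then have "p \<in> {0..1}" and *: "\<And>r. r \<in> {0..1} \<Longrightarrow> 0 \<le> ((r - p) * (2 * p - 1)) * ?k"
      unfolding nash by (auto simp only: mult.assoc)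
    have "(r - p) * (2 * p - 1) \<le> 0" if "r \<in> {0..1}" for r
      using *[OF that] \<open>?k < 0\<close> by (simp only: zero_le_mult_iff) auto
    \<comment> \<open>The signs are reversed: the more popular queue is cheaper. This rules out
      interior p other than 1/2, while at p = 0 and p = 1 everybody is already in that
      queue.\<close>
    from this[of 0] this[of 1] have "(0 - p) * (2 * p - 1) \<le> 0" "(1 - p) * (2 * p - 1) \<le> 0"
      by auto
    moreover have "0 < (0 - p) * (2 * p - 1)" if "0 < p" "p < 1/2"
      using that by (intro mult_neg_neg) auto
    moreover have "0 < (1 - p) * (2 * p - 1)" if "1/2 < p" "p < 1"
      using that by (intro mult_pos_pos) auto
    moreover have "0 \<le> p" "p \<le> 1"
      using \<open>p \<in> {0..1}\<close> by auto
    ultimately have "p = 0 \<or> p = 1/2 \<or> p = 1"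
      by linarith
    then show "p \<in> {0, 1/2, 1}"
      by simp
  next
    assume "p \<in> {0, 1/2, 1}"
    then show "nash lam mu c d p"
      using that unfolding nash by (auto simp: mult_nonneg_nonpos mult_nonpos_nonpos zero_le_mult_iff)
  qed
  have soc_eq: "socially_optimal lam mu c d p" if "c = d" "p \<in> {0..1}" for p
    using that unfolding soc by simp
  have soc_less: "socially_optimal lam mu c d p \<longleftrightarrow> p \<in> {0, 1}" if "c < d" "p \<in> {0, 1/2, 1}" for p
  proof -
    have "\<not> socially_optimal lam mu c d (1/2)"
    proof
      assume "socially_optimal lam mu c d (1/2)"
      then have "0 \<le> (d - c) * (0 * (1 - 0) - 1/2 * (1 - 1/2))"
        unfolding soc by (elim conjE ballE[of _ _ 0]) auto
      then show False
        using that by simp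
    qed
    moreover have "socially_optimal lam mu c d 0" "socially_optimal lam mu c d 1"
      using that unfolding soc by auto
    moreover have "1/2 \<notin> {0, 1 :: real}"
      by simp
    ultimately show ?thesis
      using that(2) by blast
  qed
  show ?thesis
  proof (intro conjI impI)
    assume "d < c * (1 - \<rho>)"
    then have "0 < ?k" "d \<le> c"
      using dc by linarith+
    then show "{p. nash lam mu c d p} = {1/2}" "socially_optimal lam mu c d (1/2)"
      using nash_pos half by blast+
  next
    assume "c * (1 - \<rho>) = d"
    then have "?k = 0" "d < c"
      using dc by linarith+
    then show "{p. nash lam mu c d p} = {0..1}" "{p. socially_optimal lam mu c d p} = {1/2}"
      using all_nash half[OF less_imp_le] only_half by blast+
  next
    assume "c * (1 - \<rho>) < d"
    then have "?k < 0"
      by linarith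
    then show "{p. nash lam mu c d p} = {0, 1/2, 1}"
      using nash_neg by blast
  next
    assume "d < c"
    then show "{p \<in> {0, 1/2, 1}. socially_optimal lam mu c d p} = {1/2}"
      using half[OF less_imp_le] only_half by blast
  next
    assume "c = d"
    then show "{p \<in> {0, 1/2, 1}. socially_optimal lam mu c d p} = {0, 1/2, 1}"
      using soc_eq by auto
  next
    assume "c < d"
    then show "{p \<in> {0, 1/2, 1}. socially_optimal lam mu c d p} = {0, 1}"
      using soc_less by blast
  qed
qed

end
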